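(* Let $k\ge 1$ be an integer and let $\mathbf v\in\mathcal A^*=\bigcup_{l\ge1}\mathbf A^{-2l}$. The equation $(\nabla\,\mathrm{div})^{2k}\mathbf u=\mathbf v$ is solvable in the space $\mathbf A^{2k}$ if and only if $\mathbf v\in\mathbf A^{-2k}$. Its solution $\mathbf u=\mathcal N_d^{-2k}\mathbf v=\sum_{j\ge1}\nu_j^{-4k}(\mathbf v,\mathbf q_j)\mathbf q_j$ is uniquely determined in the quotient space $\mathcal A/\mathcal A_H$.
   Context: $G\subset\mathbb R^3$ is a bounded connected domain with smooth boundary $\Gamma$, $\mathbf n$ is the unit normal on $\Gamma$, $\gamma$ denotes the trace on $\Gamma$; $\mathbf L_2(G)$ is the real Hilbert space of square integrable vector fields with inner product $(\mathbf u,\mathbf v)=\int_G\mathbf u\cdot\mathbf v\,d\mathbf x$. $\mathcal A=\{\nabla h: h\in H^1(G)\}$; $\mathcal A_H=\{\mathbf v\in\mathcal A:\nabla\mathrm{div}\,\mathbf v=0\text{ in }G,\ \gamma(\mathbf n\cdot\mathbf v)=0\}$ is the kernel of $\nabla\mathrm{div}$ in $\mathcal A$; $\mathbf A^0$ is the orthogonal complement of $\mathcal A_H$ in $\mathcal A$. $\{\mathbf q_j\}_{j\ge1}$ is a fixed orthonormal basis of $\mathbf A^0$ consisting of fields $\mathbf q_j\in\mathbf C^\infty(\overline G)$ with $-\nabla\mathrm{div}\,\mathbf q_j=\nu_j^2\mathbf q_j$ in $G$, $\gamma(\mathbf n\cdot\mathbf q_j)=0$, where $0<\nu_1^2\le\nu_2^2\le\dots$,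 eigenvalues repeated according to multiplicity. For $k\ge1$, $\mathbf A^{2k}=\{\mathbf f\in\mathbf A^0:\sum_j\nu_j^{4k}(\mathbf f,\mathbf q_j)^2<\infty\}$; on it $(\nabla\mathrm{div})^k$ coincides with $\mathcal N_d^k\mathbf f=(-1)^k\sum_j\nu_j^{2k}(\mathbf f,\mathbf q_j)\mathbf q_j$. The inner product is $\{\mathbf u,\mathbf w\}_{2k}=(\mathcal N_d^k\mathbf u,\mathcal N_d^k\mathbf w)$. $\mathbf A^{-2k}$ is the space of functionals $\mathbf v$ given by coefficients $(\mathbf v,\mathbf q_j)\in\mathbb R$, $j\ge1$ (and vanishing on $\mathcal A_H$), with $\sum_j\nu_j^{-4k}(\mathbf v,\mathbf q_j)^2<\infty$; the pairing with $\mathbf w\in\mathbf A^{2k}$ is $\sum_j(\mathbf v,\mathbf q_j)(\mathbf w,\mathbf q_j)$. For $\mathbf u\in\mathbf A^{2k}$, the equation $(\nabla\mathrm{div})^{2k}\mathbf u=\mathbf v$ means that $((\nabla\mathrm{div})^k\mathbf u,(\nabla\mathrm{div})^k\mathbf q_j)=(\mathbf v,\mathbf q_j)$ for all $j\ge1$. Uniqueness in $\mathcal A/\mathcal A_H$ means that two solutions differ by an element of $\mathcal A_H$. *)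

theory Defs
  imports "HOL-Analysis.Analysis"
begin

type_synonym field3 = "real^3 \<Rightarrow> real^3"

section \<open>Smooth functions and classical differential operators\<close>

text \<open>Continuously differentiable of order \<open>n\<close> on an open set, via iterated partial derivatives.\<close>

primrec Ck_on :: "nat \<Rightarrow> 'a::euclidean_space set \<Rightarrow> ('a \<Rightarrow> 'b::real_normed_vector) \<Rightarrow> bool" where
  "Ck_on 0 S f \<longleftrightarrow> continuous_on S f"
| "Ck_on (Suc n) S f \<longleftrightarrow> (\<forall>x\<in>S. f differentiable (at x)) \<and>
     (\<forall>e\<in>Basis. Ck_on n S (\<lambda>x. frechet_derivative f (at x) e))"

definition smooth_on :: "'a::euclidean_space set \<Rightarrow> ('a \<Rightarrow> 'b::real_normed_vector) \<Rightarrow> bool" where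
  "smooth_on S f \<longleftrightarrow> (\<forall>n. Ck_on n S f)"

definition smooth_closure :: "'a::euclidean_space set \<Rightarrow> ('a \<Rightarrow> 'b::real_normed_vector) \<Rightarrow> bool" where
  "smooth_closure G f \<longleftrightarrow> (\<exists>F. smooth_on UNIV F \<and> (\<forall>x\<in>closure G. f x = F x))"

definition test_function :: "'a::euclidean_space set \<Rightarrow> ('a \<Rightarrow> 'b::real_normed_vector) \<Rightarrow> bool" where
  "test_function G \<phi> \<longleftrightarrow> smooth_on UNIV \<phi> \<and>
     compact (closure {x. \<phi> x \<noteq> 0}) \<and> closure {x. \<phi> x \<noteq> 0} \<subseteq> G"

definition grad :: "(real^3 \<Rightarrow> real) \<Rightarrow> field3" where
  "grad f x = (\<chi> i. frechet_derivative f (at x) (axis i 1))"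

definition divg :: "field3 \<Rightarrow> real^3 \<Rightarrow> real" where
  "divg v x = (\<Sum>i\<in>UNIV. frechet_derivative v (at x) (axis i 1) $ i)"

section \<open>Bounded domains with smooth boundary\<close>

text \<open>\<open>\<rho>\<close> is a smooth function on the neighbourhood \<open>U\<close> of \<open>p\<close>, without critical points, and
  \<open>G\<close> is its negative sublevel set there; hence the boundary inside \<open>U\<close> is the zero set of \<open>\<rho>\<close>.\<close>

definition local_defining_function ::
    "(real^3) set \<Rightarrow> real^3 \<Rightarrow> (real^3) set \<Rightarrow> (real^3 \<Rightarrow> real) \<Rightarrow> bool" where
  "local_defining_function G p U \<rho> \<longleftrightarrow> open U \<and> p \<in> U \<and> smooth_on U \<rho> \<and>
     (\<forall>x\<in>U. grad \<rho> x \<noteq> 0) \<and> G \<inter> U = {x\<in>U. \<rho> x < 0}"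

definition smooth_bounded_domain :: "(real^3) set \<Rightarrow> bool" where
  "smooth_bounded_domain G \<longleftrightarrow> open G \<and> G \<noteq> {} \<and> connected G \<and> bounded G \<and>
     (\<forall>p\<in>frontier G. \<exists>U \<rho>. local_defining_function G p U \<rho>)"

text \<open>The outer unit normal; it does not depend on the local defining function.\<close>

definition unit_normal :: "(real^3) set \<Rightarrow> field3" where
  "unit_normal G p = (SOME n. \<exists>U \<rho>. local_defining_function G p U \<rho> \<and>
     n = grad \<rho> p /\<^sub>R norm (grad \<rho> p))"

section \<open>Square integrable functions and weak derivatives\<close>

text \<open>Elements of \<open>L2 G\<close> are functions, not classes modulo null sets: convergence in \<open>L2 G\<close>
  determines a limit only almost everywhere, and so do the weak operators below.
  Values outside \<open>G\<close> are irrelevant.\<close>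

definition L2 :: "(real^3) set \<Rightarrow> (real^3 \<Rightarrow> 'b::euclidean_space) set" where
  "L2 G = {f. f \<in> borel_measurable (lebesgue_on G) \<and>
              integrable (lebesgue_on G) (\<lambda>x. (norm (f x))\<^sup>2)}"

definition L2_inner :: "(real^3) set \<Rightarrow> (real^3 \<Rightarrow> 'b::euclidean_space) \<Rightarrow> (real^3 \<Rightarrow> 'b) \<Rightarrow> real" where
  "L2_inner G u v = (LINT x|lebesgue_on G. u x \<bullet> v x)"

definition L2_norm :: "(real^3) set \<Rightarrow> (real^3 \<Rightarrow> 'b::euclidean_space) \<Rightarrow> real" where
  "L2_norm G u = sqrt (L2_inner G u u)"

definition L2_sums ::
    "(real^3) set \<Rightarrow> (nat \<Rightarrow> real^3 \<Rightarrow> 'b::euclidean_space) \<Rightarrow> (real^3 \<Rightarrow> 'b) \<Rightarrow> bool" where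
  "L2_sums G f s \<longleftrightarrow> (\<forall>j. f j \<in> L2 G) \<and> s \<in> L2 G \<and>
     (\<lambda>n. L2_norm G (\<lambda>x. (\<Sum>j<n. f j x) - s x)) \<longlonglongrightarrow> 0"

definition has_weak_grad :: "(real^3) set \<Rightarrow> (real^3 \<Rightarrow> real) \<Rightarrow> field3 \<Rightarrow> bool" where
  "has_weak_grad G h v \<longleftrightarrow> h \<in> L2 G \<and> v \<in> L2 G \<and>
     (\<forall>\<psi>::field3. test_function G \<psi> \<longrightarrow> L2_inner G h (divg \<psi>) = - L2_inner G v \<psi>)"

definition has_weak_div :: "(real^3) set \<Rightarrow> field3 \<Rightarrow> (real^3 \<Rightarrow> real) \<Rightarrow> bool" where
  "has_weak_div G v g \<longleftrightarrow> v \<in> L2 G \<and> g \<in> L2 G \<and>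
     (\<forall>\<phi>::real^3 \<Rightarrow> real. test_function G \<phi> \<longrightarrow> L2_inner G v (grad \<phi>) = - L2_inner G g \<phi>)"

text \<open>\<open>w = \<nabla> div u\<close> in the sense of distributions on \<open>G\<close>.\<close>

definition has_weak_grad_div :: "(real^3) set \<Rightarrow> field3 \<Rightarrow> field3 \<Rightarrow> bool" where
  "has_weak_grad_div G u w \<longleftrightarrow> u \<in> L2 G \<and> w \<in> L2 G \<and>
     (\<forall>\<psi>::field3. test_function G \<psi> \<longrightarrow> L2_inner G u (grad (divg \<psi>)) = L2_inner G w \<psi>)"

text \<open>\<open>\<gamma>(n \<cdot> v) = 0\<close> for a field \<open>v\<close> that is merely square integrable with square integrable
  divergence: the normal trace is the functional on traces of functions \<open>h \<in> H\<^sup>1(G)\<close>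
  given by Green's formula, \<open>h \<mapsto> (v, \<nabla>h) + (div v, h)\<close>.\<close>

definition zero_normal_trace :: "(real^3) set \<Rightarrow> field3 \<Rightarrow> bool" where
  "zero_normal_trace G v \<longleftrightarrow> (\<exists>g. has_weak_div G v g \<and>
     (\<forall>h w. has_weak_grad G h w \<longrightarrow> L2_inner G v w + L2_inner G g h = 0))"

section \<open>The spaces of potential fields\<close>

definition A_space :: "(real^3) set \<Rightarrow> field3 set" where
  "A_space G = {v. \<exists>h. has_weak_grad G h v}"

definition A_H :: "(real^3) set \<Rightarrow> field3 set" where
  "A_H G = {v \<in> A_space G. has_weak_grad_div G v (\<lambda>x. 0) \<and> zero_normal_trace G v}"

definition A_zero :: "(real^3) set \<Rightarrow> field3 set" where
  "A_zero G = {f \<in> A_space G. \<forall>g\<in>A_H G. L2_inner G f g = 0}"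

text \<open>The basis is indexed from \<open>0\<close>. For fields smooth up to the boundary, the equation and the
  boundary condition are the classical pointwise ones.\<close>

definition grad_div_eigenbasis :: "(real^3) set \<Rightarrow> (nat \<Rightarrow> real) \<Rightarrow> (nat \<Rightarrow> field3) \<Rightarrow> bool" where
  "grad_div_eigenbasis G \<nu> q \<longleftrightarrow>
     (\<forall>j. q j \<in> A_zero G) \<and>
     (\<forall>i j. L2_inner G (q i) (q j) = (if i = j then 1 else 0)) \<and>
     (\<forall>f\<in>A_zero G. L2_sums G (\<lambda>j x. L2_inner G f (q j) *\<^sub>R q j x) f) \<and>
     (\<forall>j. smooth_closure G (q j)) \<and>
     (\<forall>j. \<forall>x\<in>G. - grad (divg (q j)) x = (\<nu> j)\<^sup>2 *\<^sub>R q j x) \<and>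
     (\<forall>j. \<forall>x\<in>frontier G. unit_normal G x \<bullet> q j x = 0) \<and>
     0 < (\<nu> 0)\<^sup>2 \<and> mono (\<lambda>j. (\<nu> j)\<^sup>2)"

definition A_pos :: "(real^3) set \<Rightarrow> (nat \<Rightarrow> real) \<Rightarrow> (nat \<Rightarrow> field3) \<Rightarrow> nat \<Rightarrow> field3 set" where
  "A_pos G \<nu> q k = {f \<in> A_zero G. summable (\<lambda>j. \<nu> j ^ (4 * k) * (L2_inner G f (q j))\<^sup>2)}"

text \<open>\<open>A_pos G \<nu> q k\<close> is the space of order \<open>2k\<close> and \<open>A_neg \<nu> k\<close> the one of order \<open>-2k\<close>.
  A functional \<open>v\<close> of negative order is represented by its coefficients \<open>v j = (v, q j)\<close>;
  \<open>pairing\<close> is its action on fields, which automatically vanishes on \<open>A_H G\<close>.\<close>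

definition A_neg :: "(nat \<Rightarrow> real) \<Rightarrow> nat \<Rightarrow> (nat \<Rightarrow> real) set" where
  "A_neg \<nu> k = {v. summable (\<lambda>j. (v j)\<^sup>2 / \<nu> j ^ (4 * k))}"

definition A_star :: "(nat \<Rightarrow> real) \<Rightarrow> (nat \<Rightarrow> real) set" where
  "A_star \<nu> = (\<Union>l\<in>{1..}. A_neg \<nu> l)"

definition pairing :: "(real^3) set \<Rightarrow> (nat \<Rightarrow> field3) \<Rightarrow> (nat \<Rightarrow> real) \<Rightarrow> field3 \<Rightarrow> real" where
  "pairing G q v w = (\<Sum>j. v j * L2_inner G w (q j))"

text \<open>\<open>(\<nabla> div)\<^sup>2\<^sup>k u = v\<close>, meaning \<open>((\<nabla> div)\<^sup>k u, (\<nabla> div)\<^sup>k q\<^sub>j) = (v, q\<^sub>j)\<close> for all \<open>j\<close>.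
  Both \<open>k\<close>-th powers are iterates of the distributional \<open>\<nabla> div\<close>, so \<open>w\<close> and \<open>z\<close> are determined
  almost everywhere on \<open>G\<close>.\<close>

definition solves_grad_div_eq ::
    "(real^3) set \<Rightarrow> (nat \<Rightarrow> field3) \<Rightarrow> nat \<Rightarrow> (nat \<Rightarrow> real) \<Rightarrow> field3 \<Rightarrow> bool" where
  "solves_grad_div_eq G q k v u \<longleftrightarrow>
     (\<exists>w. (has_weak_grad_div G ^^ k) u w \<and>
        (\<forall>j. \<exists>z. (has_weak_grad_div G ^^ k) (q j) z \<and> L2_inner G w z = pairing G q v (q j)))"

end

(*
  The whole problem diagonalises in the basis: if u has coefficients c_j, then (grad div)^k u has
  coefficients (-nu_j^2)^k c_j, so the equation says nu_j^(4k) c_j = v_j. Two facts carry the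
  analysis. First, distributional derivatives are determined almost everywhere, since test functions
  are dense. Second, a square summable series of the q_j converges to a gradient of a square
  integrable potential: the divergences of the q_j are orthogonal with norms nu_j, hence the
  potentials -c_j nu_j^(-2) div q_j can be summed too. That orthogonality is Green's formula for
  fields tangential to the boundary, which is proved by cutting the field off near the boundary:
  tangency makes the error term bounded although the gradient of the cutoff is not.
*)
theory Submission
  imports Defs
begin

text \<open>Two features of the definitions shape the work. The normal is an arbitrary choice among
  normalised gradients of local defining functions, so tangency of a basis field must first be
  transferred to the defining function \<rho> used for the cutoff. Then grad \<rho> \<bullet> H
  vanishes on the frontier and is Lipschitz, hence at most a multiple of \<bar>\<rho>\<bar>, which
  balances the factor n produced by differentiating \<open>flat 0 (- n * \<rho>)\<close>. Fields are
  functions rather than classes, and the equation only asserts that suitable iterated weak images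
  exist. Reading coefficients off a solution therefore needs that every admissible image gives the
  same inner products; this is where the density of test functions enters. Integration by parts is
  carried out for smooth extensions F_j of the q_j to the whole space. With P_j = div F_j one has
  grad P_i = - nu_i^2 q_i in G, and (P_i, P_j) = - (grad P_i, F_j) = nu_i^2 (q_i, q_j) yields the
  orthogonality. Uniqueness comes from the coefficients: two solutions share them, hence agree
  almost everywhere, and a null field belongs to the kernel \<open>A_H G\<close>.\<close>

section \<open>Iterated differentiability\<close>

text \<open>The derivatives in \<open>Ck_on\<close> are taken at full neighbourhoods of the points
  of \<open>S\<close>; openness of \<open>S\<close> makes them depend on the values in
  \<open>S\<close> alone.\<close>

lemma Ck_on_cong:
  assumes "open S" "\<And>x. x \<in> S \<Longrightarrow> f x = g x"
  shows "Ck_on n S f \<longleftrightarrow> Ck_on n S g"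
  using assms(2)
proof (induction n arbitrary: f g)
  case 0
  then show ?case using continuous_on_cong by force
next
  case (Suc n)
  have tr: "(g has_derivative D) (at x)" if "x \<in> S" "(f has_derivative D) (at x)"
    "\<forall>x\<in>S. f x = g x" for f g :: "'a \<Rightarrow> 'b" and x D
    by (rule has_derivative_transform_within_open[OF that(2) \<open>open S\<close> that(1)]) (use that(3) in auto)
  have eq: "\<forall>x\<in>S. f x = g x" "\<forall>x\<in>S. g x = f x" using Suc.prems by auto
  have d: "f differentiable at x \<longleftrightarrow> g differentiable at x" if "x \<in> S" for x
  proof
    show "g differentiable at x" if "f differentiable at x"
      using tr[OF \<open>x \<in> S\<close> _ eq(1)] that unfolding differentiable_def by blast
    show "f differentiable at x" if "g differentiable at x"
      using tr[OF \<open>x \<in> S\<close> _ eq(2)] that unfolding differentiable_def by blast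
  qed
  have "Ck_on n S (\<lambda>x. frechet_derivative f (at x) e) \<longleftrightarrow> Ck_on n S (\<lambda>x. frechet_derivative g (at x) e)"
    if *: "\<forall>x\<in>S. f differentiable at x" for e
  proof (rule Suc.IH)
    fix x assume "x \<in> S"
    then have "frechet_derivative f (at x) = frechet_derivative g (at x)"
      using * Suc.prems by (intro frechet_derivative_transform_within_open[OF _ \<open>open S\<close>]) auto
    then show "frechet_derivative f (at x) e = frechet_derivative g (at x) e" by simp
  qed
  with d show ?case by (simp cong: conj_cong)
qed

text \<open>Shields later proofs from \<open>frechet_derivative\<close>: the closure properties
  below propose a derivative formula, verify it once, and then only need that formula to be smooth
  of one order less.\<close>

lemma Ck_on_SucI:
  assumes "open S" "\<And>x. x \<in> S \<Longrightarrow> (f has_derivative f' x) (at x)"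
    and "\<And>e. e \<in> Basis \<Longrightarrow> Ck_on n S (\<lambda>x. f' x e)"
  shows "Ck_on (Suc n) S f"
proof -
  have "Ck_on n S (\<lambda>x. frechet_derivative f (at x) e)" if "e \<in> Basis" for e
  proof -
    have "Ck_on n S (\<lambda>x. frechet_derivative f (at x) e) \<longleftrightarrow> Ck_on n S (\<lambda>x. f' x e)"
      using assms(2) by (intro Ck_on_cong[OF \<open>open S\<close>]) (metis frechet_derivative_at)
    with assms(3)[OF that] show ?thesis by simp
  qed
  then show ?thesis using assms(2) by (auto simp: differentiable_def)
qed

lemma Ck_on_Suc_has_derivative:
  assumes "Ck_on (Suc n) S f" "x \<in> S"
  shows "(f has_derivative frechet_derivative f (at x)) (at x)"
  using assms frechet_derivative_works by auto

lemma Ck_on_Suc_frechet: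
  assumes "Ck_on (Suc n) S f" "e \<in> Basis"
  shows "Ck_on n S (\<lambda>x. frechet_derivative f (at x) e)"
  using assms by auto

lemma Ck_on_SucD: "Ck_on (Suc n) S f \<Longrightarrow> Ck_on n S f"
proof (induction n arbitrary: f)
  case 0
  then show ?case
    by (simp add: continuous_on_eq_continuous_within differentiable_imp_continuous_within
      differentiable_at_withinI)
next
  case (Suc n)
  then show ?case by (metis Ck_on.simps(2))
qed

lemma Ck_on_mono:
  assumes "Ck_on n S f" "m \<le> n"
  shows "Ck_on m S f"
  using assms(2,1) by (induction rule: dec_induct) (auto intro: Ck_on_SucD simp del: Ck_on.simps)

lemma Ck_on_continuous_on: "Ck_on n S f \<Longrightarrow> continuous_on S f"
  using Ck_on_mono[of n S f 0] by simp

lemma Ck_on_subset: "Ck_on n S f \<Longrightarrow> T \<subseteq> S \<Longrightarrow> Ck_on n T f"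
  by (induction n arbitrary: f) (auto intro: continuous_on_subset)

lemma Ck_on_Un:
  assumes "open S" "open T" "Ck_on n S f" "Ck_on n T f"
  shows "Ck_on n (S \<union> T) f"
  using assms(3,4)
proof (induction n arbitrary: f)
  case 0
  then show ?case by (simp add: continuous_on_open_Un assms(1,2))
next
  case (Suc n)
  then show ?case by simp blast
qed

lemma Ck_on_const: "open S \<Longrightarrow> Ck_on n S (\<lambda>x. c)"
proof (induction n arbitrary: c)
  case (Suc n)
  then show ?case by (intro Ck_on_SucI[where f'="\<lambda>x h. 0"]) (auto simp del: Ck_on.simps)
qed simp

lemma Ck_on_bounded_linear:
  assumes "bounded_linear L" "open S" "Ck_on n S f"
  shows "Ck_on n S (\<lambda>x. L (f x))"
  using assms(3)
proof (induction n arbitrary: f)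
  case 0
  then show ?case by (simp add: bounded_linear.continuous_on[OF assms(1)])
next
  case (Suc n)
  show ?case
  proof (rule Ck_on_SucI[where f'="\<lambda>x e. L (frechet_derivative f (at x) e)", OF \<open>open S\<close>])
    fix x assume "x \<in> S"
    then show "((\<lambda>x. L (f x)) has_derivative (\<lambda>e. L (frechet_derivative f (at x) e))) (at x)"
      by (rule bounded_linear.has_derivative[OF assms(1) Ck_on_Suc_has_derivative[OF Suc.prems]])
  qed (rule Suc.IH[OF Ck_on_Suc_frechet[OF Suc.prems]])
qed

lemma Ck_on_add:
  assumes "open S" "Ck_on n S f" "Ck_on n S g"
  shows "Ck_on n S (\<lambda>x. f x + g x)"
  using assms(2,3)
proof (induction n arbitrary: f g)
  case 0
  then show ?case by (simp add: continuous_on_add)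
next
  case (Suc n)
  show ?case
  proof (rule Ck_on_SucI[where f'="\<lambda>x e. frechet_derivative f (at x) e + frechet_derivative g (at x) e", OF \<open>open S\<close>])
    fix x assume "x \<in> S"
    then show "((\<lambda>x. f x + g x) has_derivative (\<lambda>e. frechet_derivative f (at x) e + frechet_derivative g (at x) e)) (at x)"
      by (intro has_derivative_add Ck_on_Suc_has_derivative[OF Suc.prems(1)] Ck_on_Suc_has_derivative[OF Suc.prems(2)])
  qed (intro Suc.IH Ck_on_Suc_frechet[OF Suc.prems(1)] Ck_on_Suc_frechet[OF Suc.prems(2)])
qed

lemma Ck_on_sum:
  assumes "open S" "\<And>i. i \<in> I \<Longrightarrow> Ck_on n S (f i)"
  shows "Ck_on n S (\<lambda>x. \<Sum>i\<in>I. f i x)"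
  using assms(2) by (induction I rule: infinite_finite_induct) (auto intro: Ck_on_add Ck_on_const assms(1))

lemma Ck_on_bilinear:
  assumes "bounded_bilinear B" "open S" "Ck_on n S f" "Ck_on n S g"
  shows "Ck_on n S (\<lambda>x. B (f x) (g x))"
  using assms(3,4)
proof (induction n arbitrary: f g)
  case 0
  then show ?case by (simp add: bounded_bilinear.continuous_on[OF assms(1)])
next
  case (Suc n)
  show ?case
  proof (rule Ck_on_SucI[where f'="\<lambda>x e. B (f x) (frechet_derivative g (at x) e) + B (frechet_derivative f (at x) e) (g x)", OF \<open>open S\<close>])
    fix x assume "x \<in> S"
    then show "((\<lambda>x. B (f x) (g x)) has_derivative (\<lambda>e. B (f x) (frechet_derivative g (at x) e) + B (frechet_derivative f (at x) e) (g x))) (at x)"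
      by (intro bounded_bilinear.FDERIV[OF assms(1)] Ck_on_Suc_has_derivative[OF Suc.prems(1)] Ck_on_Suc_has_derivative[OF Suc.prems(2)])
  qed (intro Ck_on_add[OF \<open>open S\<close>] Suc.IH Ck_on_Suc_frechet[OF Suc.prems(1)] Ck_on_Suc_frechet[OF Suc.prems(2)]
     Ck_on_SucD[OF Suc.prems(1)] Ck_on_SucD[OF Suc.prems(2)])
qed

lemmas Ck_on_mult = Ck_on_bilinear[OF bounded_bilinear_mult]
lemmas Ck_on_scaleR = Ck_on_bilinear[OF bounded_bilinear_scaleR]
lemmas Ck_on_inner = Ck_on_bilinear[OF bounded_bilinear_inner]

text \<open>For a real outer function the chain rule is a product with the scalar g'(f x), so the
  induction closes with \<open>Ck_on_mult\<close> and the same statement one order lower.\<close>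

lemma Ck_on_compose_real:
  fixes g :: "real \<Rightarrow> real"
  assumes "open S" "Ck_on n UNIV g" "Ck_on n S f"
  shows "Ck_on n S (\<lambda>x. g (f x))"
  using assms(2,3)
proof (induction n arbitrary: f g)
  case 0
  then show ?case by (auto intro: continuous_on_compose2[of UNIV g])
next
  case (Suc n)
  show ?case
  proof (rule Ck_on_SucI[where f'="\<lambda>x e. frechet_derivative f (at x) e * frechet_derivative g (at (f x)) 1", OF \<open>open S\<close>])
    fix x assume x: "x \<in> S"
    have g: "(g has_derivative frechet_derivative g (at (f x))) (at (f x))"
      by (rule Ck_on_Suc_has_derivative[OF Suc.prems(1)]) simp
    have l: "frechet_derivative g (at (f x)) t = t * frechet_derivative g (at (f x)) 1" for t
      using linear_scale[OF has_derivative_linear[OF g], of t 1] by simp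
    show "((\<lambda>x. g (f x)) has_derivative (\<lambda>e. frechet_derivative f (at x) e * frechet_derivative g (at (f x)) 1)) (at x)"
      using diff_chain_at[OF Ck_on_Suc_has_derivative[OF Suc.prems(2) x] g] unfolding o_def
      by (rule has_derivative_eq_rhs) (rule ext, rule l)
  next
    fix e :: 'a assume "e \<in> Basis"
    have "Ck_on n S (\<lambda>x. frechet_derivative g (at (f x)) 1)"
      by (rule Suc.IH[OF Ck_on_Suc_frechet[OF Suc.prems(1)] Ck_on_SucD[OF Suc.prems(2)]]) simp
    then show "Ck_on n S (\<lambda>x. frechet_derivative f (at x) e * frechet_derivative g (at (f x)) 1)"
      by (rule Ck_on_mult[OF \<open>open S\<close> Ck_on_Suc_frechet[OF Suc.prems(2) \<open>e \<in> Basis\<close>]])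
  qed
qed

lemma Ck_on_linear:
  assumes "bounded_linear L" "open S"
  shows "Ck_on n S L"
proof (cases n)
  case 0
  then show ?thesis using assms by (simp add: linear_continuous_on)
next
  case (Suc m)
  then show ?thesis
    using assms by (auto intro!: Ck_on_SucI[where f'="\<lambda>x. L"] Ck_on_const bounded_linear_imp_has_derivative simp del: Ck_on.simps)
qed

text \<open>The open sets \<open>U\<close> and \<open>- K\<close> cover the space and
  \<open>f\<close> is smooth on each. This globalises products of a locally defined cutoff with a
  field supported inside \<open>U\<close>.\<close>

lemma Ck_on_extend_by_zero:
  fixes f :: "'a::euclidean_space \<Rightarrow> 'b::real_normed_vector"
  assumes "open U" "Ck_on n U f" "closed K" "K \<subseteq> U" "\<And>x. x \<notin> K \<Longrightarrow> f x = 0"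
  shows "Ck_on n UNIV f"
proof -
  have "Ck_on n (- K) f \<longleftrightarrow> Ck_on n (- K) (\<lambda>x. 0 :: 'b)"
    by (rule Ck_on_cong) (use assms(3,5) in auto)
  then have "Ck_on n (- K) f" using assms by (simp add: Ck_on_const open_Compl)
  then have "Ck_on n (U \<union> - K) f" using assms by (intro Ck_on_Un) auto
  moreover have "U \<union> - K = UNIV" using assms by auto
  ultimately show ?thesis by simp
qed

section \<open>A smooth function that is flat at the origin\<close>

text \<open>The family over all \<open>k\<close> is closed, up to linear combinations, under differentiation, so smoothness
  follows by induction without computing higher derivatives.\<close>

definition flat :: "nat \<Rightarrow> real \<Rightarrow> real" where
  "flat k t = (if t > 0 then exp (- 1 / t) / t ^ k else 0)"

lemma flat_tendsto_0: "(flat k \<longlongrightarrow> 0) (at 0)"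
proof -
  have "((\<lambda>y::real. y ^ k / exp y) \<longlongrightarrow> 0) at_top" by (rule tendsto_power_div_exp_0)
  then have "((\<lambda>t::real. inverse t ^ k / exp (inverse t)) \<longlongrightarrow> 0) (at_right 0)"
    by (rule filterlim_compose[OF _ filterlim_inverse_at_top_right])
  moreover have "eventually (\<lambda>t. inverse t ^ k / exp (inverse t) = flat k t) (at_right 0)"
    by (auto simp: eventually_at_filter flat_def exp_minus divide_inverse power_inverse mult.commute)
  ultimately have r: "(flat k \<longlongrightarrow> 0) (at_right 0)"
    by (rule Lim_transform_eventually)
  have "eventually (\<lambda>t. 0 = flat k t) (at_left 0)"
    by (auto simp: eventually_at_filter flat_def)
  then have "(flat k \<longlongrightarrow> 0) (at_left 0)"
    by (rule Lim_transform_eventually[OF tendsto_const])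
  with r show ?thesis by (simp add: filterlim_at_split)
qed

text \<open>For t > 0, differentiating exp (-1/t) contributes a factor t^-2, and differentiating
  t^-k a factor -k t^-1, so the family reproduces itself. At t = 0 the difference quotient of
  \<open>flat k\<close> is \<open>flat (k + 1)\<close>, which tends to 0.\<close>

lemma flat_has_derivative:
  "(flat k has_real_derivative flat (k + 2) t - k * flat (k + 1) t) (at t)"
proof -
  consider "t < 0" | "t = 0" | "t > 0" by linarith
  then show ?thesis
  proof cases
    case 1
    have "((\<lambda>t. 0) has_real_derivative 0) (at t)" by simp
    then have "(flat k has_real_derivative 0) (at t)"
      by (rule has_field_derivative_transform_within_open[where S="{..<0}"]) (use 1 in \<open>auto simp: flat_def\<close>)
    then show ?thesis using 1 by (simp add: flat_def)
  next
    case 2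
    have "((\<lambda>h. (flat k (0 + h) - flat k 0) / h) \<longlongrightarrow> 0) (at 0)"
    proof (rule Lim_transform_eventually[OF flat_tendsto_0[of "Suc k"]])
      show "\<forall>\<^sub>F h in at 0. flat (Suc k) h = (flat k (0 + h) - flat k 0) / h"
        by (auto simp: eventually_at_filter flat_def)
    qed
    then show ?thesis using 2 by (simp add: DERIV_def flat_def)
  next
    case 3
    have e: "((\<lambda>t. exp (- 1 / t)) has_real_derivative exp (- 1 / t) / t\<^sup>2) (at t)"
      using 3 by (auto intro!: derivative_eq_intros simp: power2_eq_square)
    have alg: "(E / (t * t) * (t * a) - E * (M * a)) / (t * a * (t * a))
        = E / (t * (t * (t * a))) - M * (E / (t * (t * a)))" if "a \<noteq> 0" for E M a
      using 3 that by (simp add: diff_divide_distrib)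
    \<comment> \<open>The exponent \<open>k - Suc 0\<close> is truncated: for k = 0 the term
      disappears through its factor k, otherwise one power of t cancels.\<close>
    have "(exp (- 1 / t) / t\<^sup>2 * t ^ k - exp (- 1 / t) * (k * t ^ (k - Suc 0))) / (t ^ k * t ^ k)
        = flat (k + 2) t - k * flat (k + 1) t"
    proof (cases k)
      case 0
      then show ?thesis using 3 by (simp add: flat_def power2_eq_square)
    next
      case (Suc m)
      then show ?thesis
        using alg[of "t ^ m" "exp (- 1 / t)" "real k"] 3 by (simp add: flat_def power2_eq_square)
    qed
    moreover have "((\<lambda>t. exp (- 1 / t) / t ^ k) has_real_derivative
        (exp (- 1 / t) / t\<^sup>2 * t ^ k - exp (- 1 / t) * (k * t ^ (k - Suc 0))) / (t ^ k * t ^ k)) (at t)"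
      by (rule DERIV_divide[OF e DERIV_pow]) (use 3 in simp)
    ultimately have "((\<lambda>t. exp (- 1 / t) / t ^ k) has_real_derivative flat (k + 2) t - k * flat (k + 1) t) (at t)"
      by simp
    then show ?thesis
      by (rule has_field_derivative_transform_within_open[where S="{0<..}"]) (use 3 in \<open>auto simp: flat_def\<close>)
  qed
qed

lemma Ck_on_flat: "Ck_on n UNIV (flat k)"
proof (induction n arbitrary: k)
  case 0
  then show ?case
    using DERIV_isCont[OF flat_has_derivative] by (auto intro: continuous_at_imp_continuous_on)
next
  case (Suc n)
  show ?case
  proof (rule Ck_on_SucI)
    fix t show "(flat k has_derivative (\<lambda>h. h *\<^sub>R (flat (k + 2) t + (- real k) *\<^sub>R flat (k + 1) t))) (at t)"
      using flat_has_derivative[of k t] unfolding has_field_derivative_def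
      by (rule has_derivative_eq_rhs) auto
  next
    fix e :: real
    show "Ck_on n UNIV (\<lambda>t. e *\<^sub>R (flat (k + 2) t + (- real k) *\<^sub>R flat (k + 1) t))"
      by (intro Ck_on_bounded_linear[OF bounded_linear_scaleR_right] Ck_on_add Suc) auto
  qed simp
qed

section \<open>Integrals of derivatives\<close>

lemma lborel_integral_translation:
  fixes f :: "'a::euclidean_space \<Rightarrow> real"
  assumes [measurable]: "f \<in> borel_measurable borel"
  shows "(LINT x|lborel. f (c + x)) = (LINT x|lborel. f x)"
    and "integrable lborel f \<Longrightarrow> integrable lborel (\<lambda>x. f (c + x))"
proof -
  show "(LINT x|lborel. f (c + x)) = (LINT x|lborel. f x)"
    by (subst (2) lborel_distr_plus[of c, symmetric], subst integral_distr) auto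
  have "integrable lborel (\<lambda>x. f (c + x)) \<longleftrightarrow> integrable (distr lborel borel ((+) c)) f"
    by (subst integrable_distr_eq) auto
  then show "integrable lborel (\<lambda>x. f (c + x))" if "integrable lborel f"
    using that by (simp add: lborel_distr_plus)
qed

lemma continuous_compact_support_integrable:
  fixes f :: "'a::euclidean_space \<Rightarrow> 'b::euclidean_space"
  assumes "continuous_on UNIV f" "compact K" "\<And>x. x \<notin> K \<Longrightarrow> f x = 0"
  shows "integrable lborel f"
proof -
  have "set_integrable lborel K f"
    unfolding set_integrable_def
    by (rule borel_integrable_compact[OF assms(2) continuous_on_subset[OF assms(1)]]) simp
  moreover have "(\<lambda>x. indicator K x *\<^sub>R f x) = f"
    using assms(3) by (auto simp: indicator_def)
  ultimately show ?thesis by (simp add: set_integrable_def)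
qed

lemma continuous_compact_support_bounded:
  fixes f :: "'a::euclidean_space \<Rightarrow> 'b::real_normed_vector"
  assumes "continuous_on UNIV f" "compact K" "\<And>x. x \<notin> K \<Longrightarrow> f x = 0"
  obtains C where "C > 0" "\<And>x. norm (f x) \<le> C"
proof -
  have "bounded (f ` K)"
    by (intro compact_imp_bounded compact_continuous_image continuous_on_subset[OF assms(1)] assms(2)) simp
  then obtain C where C: "C > 0" "\<And>x. x \<in> K \<Longrightarrow> norm (f x) \<le> C" by (auto simp: bounded_pos)
  have "norm (f x) \<le> C" for x using C assms(3)[of x] by (cases "x \<in> K") auto
  then show thesis using C(1) that by blast
qed

lemma frechet_derivative_zero_off:
  assumes "closed K" "\<And>x. x \<notin> K \<Longrightarrow> f x = 0" "x \<notin> K"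
  shows "frechet_derivative f (at x) = (\<lambda>h. 0)"
proof -
  have "(f has_derivative (\<lambda>h. 0)) (at x)"
    by (rule has_derivative_transform_within_open[OF has_derivative_const open_Compl[OF assms(1)]])
       (use assms in auto)
  then show ?thesis by (metis frechet_derivative_at)
qed

text \<open>By translation invariance every difference quotient of \<open>f\<close> has integral
  zero. The quotients converge to the derivative, and the mean value theorem supplies an integrable
  bound.\<close>

lemma integral_derivative_compact_support:
  fixes f :: "'a::euclidean_space \<Rightarrow> real"
  assumes f: "Ck_on 1 UNIV f" and K: "compact K" "\<And>x. x \<notin> K \<Longrightarrow> f x = 0" and e: "e \<in> Basis"
  shows "integrable lborel (\<lambda>x. frechet_derivative f (at x) e)"
    and "(LINT x|lborel. frechet_derivative f (at x) e) = 0"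
proof -
  define g where "g = (\<lambda>x. frechet_derivative f (at x) e)"
  have contf: "continuous_on UNIV f" by (rule Ck_on_continuous_on[OF f])
  have contg: "continuous_on UNIV g" using f e by (simp add: g_def)
  have g0: "g x = 0" if "x \<notin> K" for x
    using frechet_derivative_zero_off[OF compact_imp_closed[OF K(1)] K(2) that] by (simp add: g_def)
  have intg: "integrable lborel g" by (rule continuous_compact_support_integrable[OF contg K(1) g0])
  then show "integrable lborel (\<lambda>x. frechet_derivative f (at x) e)" by (simp add: g_def)
  have intf: "integrable lborel f" by (rule continuous_compact_support_integrable[OF contf K])
  obtain C where C: "C > 0" "\<And>x. norm (g x) \<le> C"
    using continuous_compact_support_bounded[OF contg K(1) g0] by blast
  have [measurable]: "f \<in> borel_measurable borel" "g \<in> borel_measurable borel"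
    using contf contg by (auto intro: borel_measurable_continuous_onI)
  obtain R where R: "\<And>x. x \<in> K \<Longrightarrow> norm x \<le> R"
    using compact_imp_bounded[OF K(1)] by (auto simp: bounded_iff)
  \<comment> \<open>Steps in (0, 1]: the shifted supports stay in the ball of radius
    \<open>R + 1\<close>, and a step is never zero, so the quotients are meaningful.\<close>
  define h where "h = (\<lambda>n::nat. inverse (real (Suc n)))"
  have h: "0 < h n" "h n \<le> 1" for n by (auto simp: h_def field_simps)
  have h0: "h \<longlonglongrightarrow> 0" unfolding h_def by (rule LIMSEQ_inverse_real_of_nat)
  define s where "s = (\<lambda>n x. (f (h n *\<^sub>R e + x) - f x) / h n)"
  have der: "((\<lambda>t. f (t *\<^sub>R e + x)) has_real_derivative g (t *\<^sub>R e + x)) (at t)" for x t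
  proof -
    have l: "((\<lambda>t. t *\<^sub>R e + x) has_derivative (\<lambda>s. s *\<^sub>R e)) (at t)"
      by (auto intro!: derivative_eq_intros)
    have d: "(f has_derivative frechet_derivative f (at (t *\<^sub>R e + x))) (at (t *\<^sub>R e + x))"
      using f by (intro Ck_on_Suc_has_derivative[of 0 UNIV]) auto
    show ?thesis
      using diff_chain_at[OF l d] linear_scale[OF has_derivative_linear[OF d]]
      by (simp add: o_def has_field_derivative_def g_def mult.commute[of _ "frechet_derivative f _ e"])
  qed
  have sb: "norm (s n x) \<le> indicator (cball 0 (R + 1)) x * C" for n x
  proof (cases "x \<in> cball 0 (R + 1)")
    case True
    obtain z where "f (h n *\<^sub>R e + x) - f (0 *\<^sub>R e + x) = (h n - 0) * g (z *\<^sub>R e + x)"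
      using MVT2[of 0 "h n" "\<lambda>t. f (t *\<^sub>R e + x)" "\<lambda>t. g (t *\<^sub>R e + x)"] der h(1)[of n] by blast
    then have "s n x = g (z *\<^sub>R e + x)" using h(1)[of n] by (simp add: s_def)
    then show ?thesis using C(2) True by simp
  next
    case False
    have "norm (h n *\<^sub>R e + x) > R"
      using norm_triangle_ineq4[of "h n *\<^sub>R e + x" "h n *\<^sub>R e"] False h[of n] e by simp
    then have "h n *\<^sub>R e + x \<notin> K" using R by force
    moreover have "x \<notin> K" using R[of x] False by auto
    ultimately show ?thesis using K(2) C(1) by (simp add: s_def)
  qed
  have "(\<lambda>n. LINT x|lborel. s n x) \<longlonglongrightarrow> (LINT x|lborel. g x)"
  proof (rule integral_dominated_convergence)
    show "integrable lborel (\<lambda>x. indicator (cball 0 (R + 1)) x * C)"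
      by (intro integrable_mult_left integrable_real_indicator emeasure_compact_finite) auto
    show "AE x in lborel. (\<lambda>n. s n x) \<longlonglongrightarrow> g x"
    proof (rule AE_I2)
      fix x
      have "((\<lambda>t. (f ((0 + t) *\<^sub>R e + x) - f (0 *\<^sub>R e + x)) / t) \<longlongrightarrow> g (0 *\<^sub>R e + x)) (at 0)"
        using der[of x 0] unfolding DERIV_def .
      moreover have "filterlim h (at 0) sequentially"
        using h0 h(1) by (auto simp: filterlim_at less_imp_neq[symmetric] intro!: eventuallyI)
      ultimately have "(\<lambda>n. (f ((0 + h n) *\<^sub>R e + x) - f (0 *\<^sub>R e + x)) / h n) \<longlonglongrightarrow> g (0 *\<^sub>R e + x)"
        by (rule filterlim_compose)
      then show "(\<lambda>n. s n x) \<longlonglongrightarrow> g x" by (simp add: s_def)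
    qed
  qed (use sb in \<open>auto simp: s_def\<close>)
  moreover have "(LINT x|lborel. s n x) = 0" for n
    using lborel_integral_translation[of f "h n *\<^sub>R e"] intf by (simp add: s_def)
  ultimately have "(LINT x|lborel. g x) = 0" by (simp add: LIMSEQ_const_iff)
  then show "(LINT x|lborel. frechet_derivative f (at x) e) = 0" by (simp add: g_def)
qed

section \<open>Gradient and divergence in coordinates\<close>

lemma Ck_on_component: "open S \<Longrightarrow> Ck_on n S F \<Longrightarrow> Ck_on n S (\<lambda>x. F x $ i)"
  by (rule Ck_on_bounded_linear[OF bounded_linear_vec_nth])

lemma frechet_derivative_component:
  assumes "F differentiable (at x)"
  shows "frechet_derivative (\<lambda>x. F x $ i) (at x) e = frechet_derivative F (at x) e $ i"
proof -
  have "((\<lambda>x. F x $ i) has_derivative (\<lambda>e. frechet_derivative F (at x) e $ i)) (at x)"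
    using assms by (intro bounded_linear.has_derivative[OF bounded_linear_vec_nth]) (simp add: frechet_derivative_works)
  then show ?thesis by (metis frechet_derivative_at)
qed

lemma integral_divg_compact_support:
  assumes F: "Ck_on 1 UNIV F" and K: "compact K" "\<And>x. x \<notin> K \<Longrightarrow> F x = 0"
  shows "integrable lborel (divg F)" and "(LINT x|lborel. divg F x) = 0"
proof -
  have d: "F differentiable (at x)" for x using F by simp
  have eq: "divg F = (\<lambda>x. \<Sum>i\<in>UNIV. frechet_derivative (\<lambda>x. F x $ i) (at x) (axis i 1))"
    by (simp add: divg_def fun_eq_iff frechet_derivative_component[OF d])
  have K': "\<And>x i. x \<notin> K \<Longrightarrow> F x $ i = 0" using K by simp
  have i: "integrable lborel (\<lambda>x. frechet_derivative (\<lambda>x. F x $ i) (at x) (axis i 1))"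
    and z: "(LINT x|lborel. frechet_derivative (\<lambda>x. F x $ i) (at x) (axis i 1)) = 0" for i
    by (rule integral_derivative_compact_support[OF Ck_on_component[OF open_UNIV F] K(1) K'],
        assumption, simp add: axis_in_Basis_iff)+
  show "integrable lborel (divg F)" unfolding eq by (intro Bochner_Integration.integrable_sum i)
  show "(LINT x|lborel. divg F x) = 0" unfolding eq
    by (subst Bochner_Integration.integral_sum) (auto simp: i z)
qed

lemma frechet_derivative_eq_grad:
  assumes "f differentiable (at x)"
  shows "frechet_derivative f (at x) t = grad f x \<bullet> t"
proof -
  have l: "linear (frechet_derivative f (at x))" using assms by (rule linear_frechet_derivative)
  have "t = (\<Sum>i\<in>UNIV. (t $ i) *\<^sub>R axis i 1)"
    by (simp add: vec_eq_iff axis_def if_distrib cong: if_cong)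
  then have "frechet_derivative f (at x) t = frechet_derivative f (at x) (\<Sum>i\<in>UNIV. (t $ i) *\<^sub>R axis i 1)"
    by simp
  also have "\<dots> = grad f x \<bullet> t"
    by (simp add: linear_sum[OF l] linear_scale[OF l] grad_def inner_vec_def mult.commute)
  finally show ?thesis .
qed

lemma has_derivative_grad:
  assumes "f differentiable (at x)"
  shows "(f has_derivative (\<lambda>t. grad f x \<bullet> t)) (at x)"
  using assms unfolding frechet_derivative_works
  by (rule has_derivative_eq_rhs) (rule ext, rule frechet_derivative_eq_grad[OF assms])

lemma divg_scaleR:
  assumes a: "a differentiable (at x)" and F: "F differentiable (at x)"
  shows "divg (\<lambda>x. a x *\<^sub>R F x) x = grad a x \<bullet> F x + a x * divg F x"
proof -
  have "((\<lambda>x. a x *\<^sub>R F x) has_derivative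
      (\<lambda>h. a x *\<^sub>R frechet_derivative F (at x) h + frechet_derivative a (at x) h *\<^sub>R F x)) (at x)"
    using a F by (intro has_derivative_scaleR) (auto simp: frechet_derivative_works)
  then have "frechet_derivative (\<lambda>x. a x *\<^sub>R F x) (at x) =
      (\<lambda>h. a x *\<^sub>R frechet_derivative F (at x) h + frechet_derivative a (at x) h *\<^sub>R F x)"
    by (rule frechet_derivative_at[symmetric])
  then show ?thesis
    by (simp add: divg_def grad_def inner_vec_def sum.distrib sum_distrib_left)
qed

lemma Ck_on_grad:
  assumes "open S" "Ck_on (Suc n) S f"
  shows "Ck_on n S (grad f)"
proof -
  have "Ck_on n S (\<lambda>x. \<Sum>i\<in>UNIV. frechet_derivative f (at x) (axis i 1) *\<^sub>R axis i (1::real))"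
    using assms by (intro Ck_on_sum Ck_on_bounded_linear[OF bounded_linear_scaleR_left]) (auto simp: axis_in_Basis_iff)
  moreover have "(\<lambda>x. \<Sum>i\<in>UNIV. frechet_derivative f (at x) (axis i 1) *\<^sub>R axis i (1::real)) = grad f"
    by (simp add: fun_eq_iff grad_def vec_eq_iff axis_def if_distrib cong: if_cong)
  ultimately show ?thesis by simp
qed

lemma Ck_on_divg:
  assumes "open S" "Ck_on (Suc n) S F"
  shows "Ck_on n S (divg F)"
proof -
  have "Ck_on n S (\<lambda>x. \<Sum>i\<in>UNIV. frechet_derivative F (at x) (axis i 1) $ i)"
    using assms by (intro Ck_on_sum Ck_on_component) (auto simp: axis_in_Basis_iff)
  then show ?thesis by (simp add: divg_def[abs_def])
qed

section \<open>Bounded domains with smooth boundary\<close>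

lemma integral_lebesgue_on_open:
  fixes g :: "'a::euclidean_space \<Rightarrow> real"
  assumes "open G" "g \<in> borel_measurable borel"
  shows "(LINT x|lebesgue_on G. g x) = (LINT x|lborel. indicator G x * g x)"
proof -
  have "(LINT x|lebesgue_on G. g x) = (LINT x|lebesgue. indicator G x * g x)"
    using assms by (subst integral_restrict_space) auto
  also have "\<dots> = (LINT x|lborel. indicator G x * g x)"
    using assms by (intro integral_completion) auto
  finally show ?thesis .
qed

lemma integrable_lebesgue_on_continuous:
  fixes g :: "'a::euclidean_space \<Rightarrow> 'b::euclidean_space"
  assumes "open G" "bounded G" "continuous_on UNIV g"
  shows "integrable (lebesgue_on G) g"
proof -
  have "set_integrable lborel (closure G) g"
    unfolding set_integrable_def using assms
    by (intro borel_integrable_compact) (auto intro: continuous_on_subset)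
  then have "set_integrable lborel G g"
    by (rule set_integrable_subset) (use assms(1) closure_subset in auto)
  then have "integrable lebesgue (\<lambda>x. indicator G x *\<^sub>R g x)"
    unfolding set_integrable_def by (intro integrable_completion[THEN iffD2] borel_measurable_integrable)
  then show ?thesis
    using assms by (subst integrable_restrict_space) auto
qed

lemma Ck_on_1_differentiable: "Ck_on 1 S f \<Longrightarrow> x \<in> S \<Longrightarrow> f differentiable (at x)"
  by simp

text \<open>The gradient is bounded on the compact ball, and convexity turns this bound into a
  Lipschitz constant. It serves to compare the normal component of a field at an interior point with
  its zero at a nearby frontier point.\<close>

lemma Ck_on_1_lipschitz_cball:
  fixes f :: "real^3 \<Rightarrow> real"
  assumes "open U" "Ck_on 1 U f" "cball p R \<subseteq> U"
  obtains L where "L \<ge> 0" "\<And>x y. x \<in> cball p R \<Longrightarrow> y \<in> cball p R \<Longrightarrow> \<bar>f x - f y\<bar> \<le> L * norm (x - y)"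
proof -
  have "Ck_on 0 U (grad f)"
    by (rule Ck_on_grad[OF assms(1)]) (use assms(2) in \<open>unfold One_nat_def\<close>)
  then have "continuous_on (cball p R) (grad f)"
    using assms(3) continuous_on_subset by auto
  then have "bounded (grad f ` cball p R)"
    by (rule compact_imp_bounded[OF compact_continuous_image[OF _ compact_cball]])
  then obtain L where L: "L > 0" "\<And>x. x \<in> cball p R \<Longrightarrow> norm (grad f x) \<le> L"
    by (auto simp: bounded_pos)
  have "norm (f x - f y) \<le> L * norm (x - y)" if "x \<in> cball p R" "y \<in> cball p R" for x y
  proof (rule differentiable_bound[OF convex_cball _ _ that])
    fix z assume z: "z \<in> cball p R"
    then have "f differentiable (at z)"
      using assms(3) by (intro Ck_on_1_differentiable[OF assms(2)] subsetD[OF assms(3)])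
    then show "(f has_derivative (\<lambda>t. grad f z \<bullet> t)) (at z within cball p R)"
      by (rule has_derivative_at_withinI[OF has_derivative_grad])
    show "onorm (\<lambda>t. grad f z \<bullet> t) \<le> L"
    proof (rule onorm_le)
      fix t
      have "norm (grad f z \<bullet> t) \<le> norm (grad f z) * norm t" by (simp add: Cauchy_Schwarz_ineq2)
      also have "\<dots> \<le> L * norm t" using L(2)[OF z] by (intro mult_right_mono) auto
      finally show "norm (grad f z \<bullet> t) \<le> L * norm t" .
    qed
  qed
  then show thesis using that[of L] L(1) by auto
qed

lemma isCont_tendsto_nhds: "isCont f p \<Longrightarrow> (f \<longlongrightarrow> f p) (nhds p)"
  by (simp add: continuous_within tendsto_at_iff_tendsto_nhds)

lemma DERIV_along_line:
  assumes "f differentiable (at (p + t *\<^sub>R e))"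
  shows "((\<lambda>s. f (p + s *\<^sub>R e)) has_real_derivative (grad f (p + t *\<^sub>R e) \<bullet> e)) (at t)"
proof -
  have "((\<lambda>s. p + s *\<^sub>R e) has_derivative (\<lambda>s. s *\<^sub>R e)) (at t)"
    by (auto intro!: derivative_eq_intros)
  from diff_chain_at[OF this has_derivative_grad[OF assms]]
  show ?thesis by (simp add: o_def has_field_derivative_def mult.commute[of _ "grad f _ \<bullet> e"])
qed

lemma local_defining_functionD:
  assumes "local_defining_function G p U \<rho>"
  shows "open U" "p \<in> U" "Ck_on n U \<rho>" "x \<in> U \<Longrightarrow> grad \<rho> x \<noteq> 0" "x \<in> U \<Longrightarrow> x \<in> G \<longleftrightarrow> \<rho> x < 0"
    "x \<in> U \<Longrightarrow> \<rho> differentiable (at x)"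
proof -
  show "open U" "p \<in> U" "x \<in> U \<Longrightarrow> grad \<rho> x \<noteq> 0" "x \<in> U \<Longrightarrow> x \<in> G \<longleftrightarrow> \<rho> x < 0"
    using assms by (auto simp: local_defining_function_def)
  show "Ck_on n U \<rho>" for n using assms by (auto simp: local_defining_function_def smooth_on_def)
  from this[of 1] show "x \<in> U \<Longrightarrow> \<rho> differentiable (at x)" by simp
qed

lemma local_defining_function_move:
  "local_defining_function G p U \<rho> \<Longrightarrow> y \<in> U \<Longrightarrow> local_defining_function G y U \<rho>"
  by (simp add: local_defining_function_def)

lemma local_defining_function_frontier:
  assumes "local_defining_function G p U \<rho>" "open G" "x \<in> U" "x \<in> frontier G"
  shows "\<rho> x = 0"
proof -
  note D = local_defining_functionD[OF assms(1)]
  have "x \<notin> G" using assms(2,4) by (simp add: frontier_def interior_open)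
  then have "\<rho> x \<ge> 0" using D(5)[OF assms(3)] by simp
  moreover have "\<not> \<rho> x > 0"
  proof
    assume "\<rho> x > 0"
    have "isCont \<rho> x" using D(6)[OF assms(3)] by (rule differentiable_imp_continuous_within)
    then have "eventually (\<lambda>y. \<rho> y > 0) (nhds x)"
      using \<open>\<rho> x > 0\<close> by (rule order_tendstoD(1)[OF isCont_tendsto_nhds])
    moreover have "eventually (\<lambda>y. y \<in> U) (nhds x)" using D(1) assms(3) by (rule eventually_nhds_in_open)
    ultimately have "eventually (\<lambda>y. y \<notin> G) (nhds x)"
      by eventually_elim (use D(5) in force)
    then obtain S where "open S" "x \<in> S" "\<forall>y\<in>S. y \<notin> G" by (auto simp: eventually_nhds)
    then have "x \<notin> closure G" by (metis closure_iff_nhds_not_empty disjoint_iff order_refl)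
    then show False using assms(4) by (simp add: frontier_def)
  qed
  ultimately show ?thesis by simp
qed

text \<open>A direction along which one defining function decreases points into the domain, so the other
  one cannot increase; applied to \<open>\<plusminus>t\<close> tilted slightly inwards this makes the gradients parallel.\<close>

lemma local_defining_functions_tangent:
  assumes l1: "local_defining_function G p U \<rho>" and l2: "local_defining_function G p U' \<rho>'"
    and G: "open G" "p \<in> frontier G" and t: "grad \<rho>' p \<bullet> t = 0"
  shows "grad \<rho> p \<bullet> t = 0"
proof -
  note D = local_defining_functionD[OF l1] and D' = local_defining_functionD[OF l2]
  have z: "\<rho> p = 0" "\<rho>' p = 0"
    using local_defining_function_frontier[OF l1 G(1) D(2) G(2)]
      local_defining_function_frontier[OF l2 G(1) D'(2) G(2)] by auto
  \<comment> \<open>Otherwise the points p + h s with small h > 0 would have \<rho> > 0 and \<rho>'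
    < 0, hence lie outside and inside \<open>G\<close> at once.\<close>
  have inward: "grad \<rho> p \<bullet> s \<le> 0" if s: "grad \<rho>' p \<bullet> s < 0" for s
  proof (rule ccontr)
    assume "\<not> grad \<rho> p \<bullet> s \<le> 0"
    then have pos: "0 < grad \<rho> (p + 0 *\<^sub>R s) \<bullet> s" by simp
    have "\<rho> differentiable (at (p + 0 *\<^sub>R s))" "\<rho>' differentiable (at (p + 0 *\<^sub>R s))"
      using D(2,6) D'(2,6) by auto
    from DERIV_pos_inc_right[OF DERIV_along_line[OF this(1)] pos] DERIV_neg_dec_right[OF DERIV_along_line[OF this(2)]] s
    obtain d d' where d: "d > 0" "\<And>h. 0 < h \<Longrightarrow> h < d \<Longrightarrow> \<rho> p < \<rho> (p + h *\<^sub>R s)"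
      and d': "d' > 0" "\<And>h. 0 < h \<Longrightarrow> h < d' \<Longrightarrow> \<rho>' (p + h *\<^sub>R s) < \<rho>' p" by auto
    have "((\<lambda>h. p + h *\<^sub>R s) \<longlongrightarrow> p + 0 *\<^sub>R s) (at_right 0)" by (intro tendsto_intros)
    then have "eventually (\<lambda>h. p + h *\<^sub>R s \<in> U \<inter> U') (at_right 0)"
      using topological_tendstoD[of _ "p + 0 *\<^sub>R s" "at_right 0" "U \<inter> U'"] D(1,2) D'(1,2) by auto
    moreover have "eventually (\<lambda>h. h \<in> {0<..<min d d'}) (at_right 0)"
      using d(1) d'(1) by (intro eventually_at_right_real) auto
    ultimately have "eventually (\<lambda>h. False) (at_right (0::real))"
    proof eventually_elim
      case (elim h)
      then have "\<rho> (p + h *\<^sub>R s) > 0" "\<rho>' (p + h *\<^sub>R s) < 0" using d(2)[of h] d'(2)[of h] z by auto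
      then show False using D(5)[of "p + h *\<^sub>R s"] D'(5)[of "p + h *\<^sub>R s"] elim by auto
    qed
    then show False by simp
  qed
  have "grad \<rho> p \<bullet> s \<le> 0" if s: "grad \<rho>' p \<bullet> s = 0" for s
  proof (rule field_le_epsilon)
    fix e :: real assume "e > 0"
    define b where "b = grad \<rho>' p"
    \<comment> \<open>The tilt against \<open>b\<close> makes \<rho>' strictly decrease; its size is
      chosen so that the estimate for \<rho> loses at most \<open>e\<close>. The summand 1 keeps the
      denominator positive.\<close>
    define d where "d = e / (1 + \<bar>grad \<rho> p \<bullet> b\<bar>)"
    have "d > 0" using \<open>e > 0\<close> by (simp add: d_def add_pos_nonneg)
    moreover have "b \<bullet> b > 0" using D'(2,4) by (simp add: b_def)
    ultimately have "grad \<rho>' p \<bullet> (s - d *\<^sub>R b) < 0" using s by (simp add: b_def inner_diff_right)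
    from inward[OF this] have "grad \<rho> p \<bullet> s \<le> d * (grad \<rho> p \<bullet> b)" by (simp add: inner_diff_right)
    also have "\<dots> \<le> d * (1 + \<bar>grad \<rho> p \<bullet> b\<bar>)" using \<open>d > 0\<close> by (intro mult_left_mono) auto
    also have "\<dots> = e" by (simp add: d_def add_nonneg_eq_0_iff)
    finally show "grad \<rho> p \<bullet> s \<le> 0 + e" by simp
  qed
  from this[of t] this[of "- t"] t show ?thesis by simp
qed

text \<open>\<open>unit_normal\<close> picks the gradient of some unknown defining function.
  Tangency with respect to that one carries over to the given \<rho>, because both gradients have
  the same orthogonal complement.\<close>

lemma unit_normal_tangent:
  assumes l: "local_defining_function G p U \<rho>" and G: "open G" "p \<in> frontier G"
    and t: "unit_normal G p \<bullet> t = 0"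
  shows "grad \<rho> p \<bullet> t = 0"
proof -
  have "\<exists>n. \<exists>U \<rho>. local_defining_function G p U \<rho> \<and> n = grad \<rho> p /\<^sub>R norm (grad \<rho> p)"
    using l by blast
  from someI_ex[OF this] obtain U' \<rho>' where l': "local_defining_function G p U' \<rho>'"
    and n: "unit_normal G p = grad \<rho>' p /\<^sub>R norm (grad \<rho>' p)"
    unfolding unit_normal_def by blast
  have "grad \<rho>' p \<noteq> 0" using local_defining_functionD(2,4)[OF l'] by blast
  with t n have "grad \<rho>' p \<bullet> t = 0" by simp
  then show ?thesis by (rule local_defining_functions_tangent[OF l l' G])
qed

text \<open>Moving from x along the fixed direction grad \<rho> p, near p the value of \<rho> grows
  at a rate of at least \<open>m\<close>. It therefore reaches 0 after time at most \<bar>\<rho>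
  x\<bar> / m, and the segment meets the frontier before that. The second ball of radius
  \<open>R\<close> contains the frontier points found.\<close>

lemma frontier_within_defining_function:
  assumes l: "local_defining_function G p U \<rho>" and G: "open G" "p \<in> frontier G"
  obtains r R c where "0 < r" "r \<le> R" "cball p R \<subseteq> U" "0 \<le> c"
    "\<And>x. x \<in> G \<Longrightarrow> x \<in> cball p r \<Longrightarrow> \<exists>y\<in>frontier G \<inter> cball p R. norm (x - y) \<le> c * \<bar>\<rho> x\<bar>"
proof -
  note D = local_defining_functionD[OF l]
  define e where "e = grad \<rho> p"
  \<comment> \<open>Half of the growth rate at p itself, so that by continuity it is still exceeded
    in a whole neighbourhood.\<close>
  define m where "m = (e \<bullet> e) / 2"
  have e: "e \<bullet> e > 0" using D(2,4) by (simp add: e_def)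
  then have m: "m > 0" by (simp add: m_def)
  have "Ck_on 0 U (grad \<rho>)" by (rule Ck_on_grad[OF D(1) D(3)])
  then have "continuous_on U (\<lambda>x. grad \<rho> x \<bullet> e)" by (auto intro: continuous_intros)
  then have "isCont (\<lambda>x. grad \<rho> x \<bullet> e) p" using D(1,2) by (simp add: continuous_on_eq_continuous_at)
  then have "eventually (\<lambda>x. grad \<rho> x \<bullet> e > m) (nhds p)"
    by (rule order_tendstoD(1)[OF isCont_tendsto_nhds]) (use e in \<open>simp add: m_def e_def\<close>)
  moreover have "eventually (\<lambda>x. x \<in> U) (nhds p)" using D(1,2) by (rule eventually_nhds_in_open)
  ultimately have "eventually (\<lambda>x. x \<in> U \<and> grad \<rho> x \<bullet> e > m) (nhds p)" by eventually_elim auto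
  then obtain R0 where R0: "R0 > 0" "\<And>x. dist x p < R0 \<Longrightarrow> x \<in> U \<and> grad \<rho> x \<bullet> e > m"
    by (auto simp: eventually_nhds_metric)
  define R where "R = R0 / 2"
  have R: "R > 0" "\<And>x. x \<in> cball p R \<Longrightarrow> x \<in> U \<and> grad \<rho> x \<bullet> e > m"
    using R0 by (auto simp: R_def dist_commute)
  define c where "c = norm e / m"
  have "isCont (\<lambda>x. c * \<bar>\<rho> x\<bar>) p"
    using differentiable_imp_continuous_within[OF D(6)[OF D(2)]] by (intro continuous_intros)
  moreover have "\<rho> p = 0" by (rule local_defining_function_frontier[OF l G(1) D(2) G(2)])
  ultimately have "eventually (\<lambda>x. c * \<bar>\<rho> x\<bar> < R / 2) (nhds p)"
    using R(1) by (intro order_tendstoD(2)[OF isCont_tendsto_nhds]) auto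
  then obtain r0 where r0: "r0 > 0" "\<And>x. dist x p < r0 \<Longrightarrow> c * \<bar>\<rho> x\<bar> < R / 2"
    by (auto simp: eventually_nhds_metric)
  \<comment> \<open>Both the distance from x to p and the length of the segment to be walked are
    then at most R / 2, which keeps the segment in \<open>cball p R\<close>.\<close>
  define r where "r = min (r0 / 2) (R / 2)"
  show thesis
  proof (rule that[of r R c])
    show "0 < r" "r \<le> R" using r0 R by (auto simp: r_def)
    show "cball p R \<subseteq> U" using R by auto
    show "0 \<le> c" using m by (simp add: c_def)
    fix x assume x: "x \<in> G" "x \<in> cball p r"
    have xp: "dist p x \<le> R / 2" "c * \<bar>\<rho> x\<bar> < R / 2"
      using x(2) r0 by (auto simp: r_def dist_commute)
    \<comment> \<open>The time after which growth at rate \<open>m\<close> has certainly compensated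
      the negative value at x.\<close>
    define T where "T = \<bar>\<rho> x\<bar> / m"
    have cT: "T * norm e = c * \<bar>\<rho> x\<bar>" by (simp add: T_def c_def)
    have T: "T \<ge> 0" using m by (simp add: T_def)
    have inb: "x + t *\<^sub>R e \<in> cball p R" and near: "norm (x - (x + t *\<^sub>R e)) \<le> c * \<bar>\<rho> x\<bar>"
      if "t \<in> {0..T}" for t
    proof -
      have "t * norm e \<le> T * norm e" using that by (intro mult_right_mono) auto
      then show n: "norm (x - (x + t *\<^sub>R e)) \<le> c * \<bar>\<rho> x\<bar>" using that cT by simp
      have "dist p (x + t *\<^sub>R e) \<le> dist p x + dist x (x + t *\<^sub>R e)" by (rule dist_triangle)
      then show "x + t *\<^sub>R e \<in> cball p R" using n xp by (simp add: dist_norm)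
    qed
    have x0: "\<rho> x < 0" using D(5)[of x] x R(2)[of x] xp R(1) by auto
    then have Tp: "T > 0" using m by (simp add: T_def divide_neg_pos)
    have "\<exists>z. 0 < z \<and> z < T \<and> \<rho> (x + T *\<^sub>R e) - \<rho> (x + 0 *\<^sub>R e) = (T - 0) * (grad \<rho> (x + z *\<^sub>R e) \<bullet> e)"
      using Tp by (rule MVT2) (use inb R(2) D(6) in \<open>auto intro!: DERIV_along_line\<close>)
    then obtain z where z: "0 < z" "z < T" "\<rho> (x + T *\<^sub>R e) - \<rho> x = T * (grad \<rho> (x + z *\<^sub>R e) \<bullet> e)"
      by auto
    have "T * m \<le> T * (grad \<rho> (x + z *\<^sub>R e) \<bullet> e)"
      using T z R(2)[OF inb, of z] by (intro mult_left_mono) auto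
    then have "\<rho> (x + T *\<^sub>R e) \<ge> 0" using z(3) x0 m by (simp add: T_def)
    then have out: "x + T *\<^sub>R e \<notin> G" using D(5)[of "x + T *\<^sub>R e"] R(2)[OF inb, of T] T by auto
    define S where "S = (\<lambda>t. x + t *\<^sub>R e) ` {0..T}"
    have "connected S" unfolding S_def by (intro connected_continuous_image continuous_intros) auto
    moreover have "x \<in> S" unfolding S_def using T by (intro image_eqI[of _ _ 0]) auto
    moreover have "x + T *\<^sub>R e \<in> S" unfolding S_def using T by auto
    ultimately have "S \<inter> frontier G \<noteq> {}" using x(1) out by (intro connected_Int_frontier) auto
    then obtain t where "t \<in> {0..T}" "x + t *\<^sub>R e \<in> frontier G" unfolding S_def by blast
    then show "\<exists>y\<in>frontier G \<inter> cball p R. norm (x - y) \<le> c * \<bar>\<rho> x\<bar>"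
      using inb near by (intro bexI[of _ "x + t *\<^sub>R e"]) auto
  qed
qed

section \<open>The divergence theorem for tangential fields\<close>

lemma flat_eq_0: "t \<le> 0 \<Longrightarrow> flat k t = 0"
  by (simp add: flat_def)

lemma flat_pos: "t > 0 \<Longrightarrow> flat k t > 0"
  by (simp add: flat_def)

lemma flat_0_le_1: "0 \<le> flat 0 t" "flat 0 t \<le> 1"
  by (auto simp: flat_def)

lemma flat_0_mono: "s \<le> t \<Longrightarrow> flat 0 s \<le> flat 0 t"
  by (auto simp: flat_def frac_le)

text \<open>The upper bound is exp (1/t) \<ge> 1/t in disguise. It bounds the error term of the
  cutoff uniformly in its steepness.\<close>

lemma flat_1_le_1: "0 \<le> flat 1 t" "flat 1 t \<le> 1"
proof -
  have "exp (- 1 / t) \<le> t" if "t > 0"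
  proof -
    have "1 / t \<le> exp (1 / t)" using exp_ge_add_one_self[of "1 / t"] by linarith
    then have "1 \<le> t * exp (1 / t)" using that by (simp add: field_simps)
    then have "1 / exp (1 / t) \<le> t" by (simp add: divide_le_eq)
    then show ?thesis by (simp add: exp_minus divide_inverse)
  qed
  then show "0 \<le> flat 1 t" "flat 1 t \<le> 1" by (auto simp: flat_def)
qed

text \<open>With t = n \<bar>\<rho>\<bar> this absorbs the factor n from the gradient of the cutoff
  into the factor \<bar>\<rho>\<bar> supplied by tangency.\<close>

lemma flat_2: "t * flat 2 t = flat 1 t"
  by (simp add: flat_def power2_eq_square)

lemma flat_0_at_top: "(flat 0 \<longlongrightarrow> 1) at_top"
proof -
  have "((\<lambda>t::real. exp (- (1 / t))) \<longlongrightarrow> exp (- 0)) at_top"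
    by (intro tendsto_intros tendsto_divide_0[OF tendsto_const] filterlim_at_top_imp_at_infinity filterlim_ident)
  moreover have "eventually (\<lambda>t. exp (- (1 / t)) = flat 0 t) at_top"
    using eventually_gt_at_top[of 0] by eventually_elim (simp add: flat_def)
  ultimately show ?thesis by (auto intro: Lim_transform_eventually)
qed

lemma flat_1_at_top: "(flat 1 \<longlongrightarrow> 0) at_top"
proof (rule tendsto_sandwich[OF _ _ tendsto_const])
  show "eventually (\<lambda>t. 0 \<le> flat 1 t) at_top"
    using flat_1_le_1 by (intro always_eventually) blast
  show "eventually (\<lambda>t. flat 1 t \<le> 1 / t) at_top"
    using eventually_gt_at_top[of 0] by eventually_elim (simp add: flat_def divide_right_mono)
  show "((\<lambda>t::real. 1 / t) \<longlongrightarrow> 0) at_top"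
    by (intro tendsto_divide_0[OF tendsto_const] filterlim_at_top_imp_at_infinity filterlim_ident)
qed

lemma grad_flat_compose:
  assumes "\<rho> differentiable (at x)"
  shows "(\<lambda>x. flat 0 (c * \<rho> x)) differentiable (at x)"
    and "grad (\<lambda>x. flat 0 (c * \<rho> x)) x = (c * flat 2 (c * \<rho> x)) *\<^sub>R grad \<rho> x"
proof -
  have i: "((\<lambda>x. c * \<rho> x) has_derivative (\<lambda>t. c * (grad \<rho> x \<bullet> t))) (at x)"
    by (intro has_derivative_mult_right has_derivative_grad assms)
  \<comment> \<open>For k = 0 the second term of the derivative formula vanishes and only
    \<open>flat 2\<close> is left.\<close>
  have o: "(flat 0 has_derivative (*) (flat 2 (c * \<rho> x))) (at (c * \<rho> x))"
    using flat_has_derivative[of 0 "c * \<rho> x"] by (simp add: has_field_derivative_def numeral_2_eq_2)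
  have d: "((\<lambda>x. flat 0 (c * \<rho> x)) has_derivative (\<lambda>t. flat 2 (c * \<rho> x) * (c * (grad \<rho> x \<bullet> t)))) (at x)"
    using diff_chain_at[OF i o] by (simp add: o_def)
  then show "(\<lambda>x. flat 0 (c * \<rho> x)) differentiable (at x)" by (auto simp: differentiable_def)
  show "grad (\<lambda>x. flat 0 (c * \<rho> x)) x = (c * flat 2 (c * \<rho> x)) *\<^sub>R grad \<rho> x"
    by (simp add: vec_eq_iff grad_def[of "\<lambda>x. flat 0 (c * \<rho> x)"] frechet_derivative_at[OF d, symmetric]
      inner_axis mult_ac)
qed

lemma divg_zero_off:
  fixes F :: field3
  assumes "closed K" "\<And>x. x \<notin> K \<Longrightarrow> F x = 0" "x \<notin> K"
  shows "divg F x = 0"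
proof -
  have "frechet_derivative F (at x) = (\<lambda>h. 0)"
    by (rule frechet_derivative_zero_off[OF assms(1)]) (use assms(2,3) in auto)
  then show ?thesis by (simp add: divg_def)
qed

lemma divergence_theorem_interior:
  assumes G: "open G" and H: "Ck_on 1 UNIV H" and K: "compact K" "K \<subseteq> G" "\<And>x. x \<notin> K \<Longrightarrow> H x = 0"
  shows "(LINT x|lebesgue_on G. divg H x) = 0"
proof -
  have "Ck_on 0 UNIV (divg H)" using H by (intro Ck_on_divg) auto
  then have m: "divg H \<in> borel_measurable borel" by (auto intro: borel_measurable_continuous_onI)
  have "indicator G x * divg H x = divg H x" for x
    using divg_zero_off[OF compact_imp_closed[OF K(1)], of H x] K(2,3) by (auto simp: indicator_def)
  then have "(\<lambda>x. indicator G x * divg H x) = divg H" by (rule ext)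
  then show ?thesis
    using integral_divg_compact_support(2)[OF H K(1,3)] integral_lebesgue_on_open[OF G m] by simp
qed

text \<open>The field is cut off by \<open>flat 0 (- N \<rho>)\<close>, which vanishes outside the domain. On the domain
  tangency gives \<open>\<bar>\<nabla>\<rho> \<bullet> H\<bar> \<le> C \<bar>\<rho>\<bar>\<close>, so the extra term in the divergence of the cut off field stays
  bounded and tends to zero pointwise as \<open>N\<close> grows.\<close>

lemma divergence_theorem_at_frontier:
  assumes l: "local_defining_function G p U \<rho>" and G: "open G" "p \<in> frontier G"
  obtains r where "r > 0"
    "\<And>H. Ck_on 1 UNIV H \<Longrightarrow> (\<And>x. x \<in> frontier G \<Longrightarrow> unit_normal G x \<bullet> H x = 0) \<Longrightarrow>
      (\<And>x. x \<notin> cball p r \<Longrightarrow> H x = 0) \<Longrightarrow> (LINT x|lebesgue_on G. divg H x) = 0"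
proof -
  note D = local_defining_functionD[OF l]
  obtain r R c where r: "0 < r" "r \<le> R" "cball p R \<subseteq> U" "0 \<le> c"
    and fr: "\<And>x. x \<in> G \<Longrightarrow> x \<in> cball p r \<Longrightarrow> \<exists>y\<in>frontier G \<inter> cball p R. norm (x - y) \<le> c * \<bar>\<rho> x\<bar>"
    by (rule frontier_within_defining_function[OF l G]) blast
  have KU: "cball p r \<subseteq> U" using r by auto
  show thesis
  proof (rule that[OF r(1)])
    fix H assume H: "Ck_on 1 UNIV H" and tang: "\<And>x. x \<in> frontier G \<Longrightarrow> unit_normal G x \<bullet> H x = 0"
      and K: "\<And>x. x \<notin> cball p r \<Longrightarrow> H x = 0"
    define \<Phi> where "\<Phi> = (\<lambda>x. grad \<rho> x \<bullet> H x)"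
    have "Ck_on 1 U (grad \<rho>)" by (rule Ck_on_grad[OF D(1) D(3)])
    then have "Ck_on 1 U \<Phi>" unfolding \<Phi>_def
      by (rule Ck_on_inner[OF D(1) _ Ck_on_subset[OF H subset_UNIV]])
    from Ck_on_1_lipschitz_cball[OF D(1) this r(3)] obtain L where L: "L \<ge> 0"
      "\<And>x y. x \<in> cball p R \<Longrightarrow> y \<in> cball p R \<Longrightarrow> \<bar>\<Phi> x - \<Phi> y\<bar> \<le> L * norm (x - y)" by blast
    define C where "C = L * c"
    have C0: "C \<ge> 0" using L(1) r(4) by (simp add: C_def)
    have \<Phi>: "\<bar>\<Phi> x\<bar> \<le> C * \<bar>\<rho> x\<bar>" if x: "x \<in> G" for x
    proof (cases "x \<in> cball p r")
      case True
      from fr[OF x True] obtain y where y: "y \<in> frontier G" "y \<in> cball p R" "norm (x - y) \<le> c * \<bar>\<rho> x\<bar>"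
        by blast
      have "y \<in> U" using r(3) y(2) by auto
      \<comment> \<open>The frontier point y is in general not p, so the same \<rho> is regarded as
        a defining function at y.\<close>
      from unit_normal_tangent[OF local_defining_function_move[OF l this] G(1) y(1) tang[OF y(1)]]
      have "\<Phi> y = 0" by (simp add: \<Phi>_def)
      then have "\<bar>\<Phi> x\<bar> \<le> L * norm (x - y)" using L(2)[of x y] True r(2) y(2) by auto
      also have "\<dots> \<le> L * (c * \<bar>\<rho> x\<bar>)" by (intro mult_left_mono y(3) L(1))
      finally show ?thesis by (simp add: C_def mult.assoc)
    next
      case False
      then show ?thesis using K[OF False] C0 by (simp add: \<Phi>_def)
    qed
    define a where "a = (\<lambda>n::nat. \<lambda>x. flat 0 (- real n * \<rho> x))"
    define s where "s = (\<lambda>n x. divg (\<lambda>x. a n x *\<^sub>R H x) x)"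
    have Hd: "H differentiable (at x)" for x by (rule Ck_on_1_differentiable[OF H]) simp
    have aU: "Ck_on 1 U (a n)" for n unfolding a_def
      by (intro Ck_on_compose_real[OF D(1) Ck_on_flat] Ck_on_mult[OF D(1) Ck_on_const[OF D(1)] D(3)])
    \<comment> \<open>\<open>a n\<close> is controlled only on \<open>U\<close>, but
      \<open>H\<close> vanishes off a closed ball inside \<open>U\<close>, so the product is
      continuously differentiable everywhere.\<close>
    have aH: "Ck_on 1 UNIV (\<lambda>x. a n x *\<^sub>R H x)" for n
    proof (rule Ck_on_extend_by_zero[OF D(1) _ closed_cball KU])
      show "Ck_on 1 U (\<lambda>x. a n x *\<^sub>R H x)"
        by (rule Ck_on_scaleR[OF D(1) aU Ck_on_subset[OF H subset_UNIV]])
    qed (simp add: K)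
    have aH0: "\<And>n x. x \<notin> cball p r \<Longrightarrow> a n x *\<^sub>R H x = 0" using K by simp
    have s_int: "(LINT x|lborel. s n x) = 0" for n
      unfolding s_def by (rule integral_divg_compact_support(2)[OF aH compact_cball aH0])
    \<comment> \<open>Off \<open>G\<close> one has \<rho> \<ge> 0 within \<open>U\<close>, where
      both \<open>flat\<close> factors vanish; hence the divergence, whose integral over the whole
      space is zero, lives on \<open>G\<close> alone.\<close>
    have s_eq: "s n x = indicator G x * (a n x * divg H x - n * flat 2 (- real n * \<rho> x) * \<Phi> x)" for n x
    proof (cases "x \<in> U")
      case True
      have "s n x = grad (a n) x \<bullet> H x + a n x * divg H x"
        unfolding s_def by (rule divg_scaleR[OF Ck_on_1_differentiable[OF aU True] Hd])
      also have "grad (a n) x = (- real n * flat 2 (- real n * \<rho> x)) *\<^sub>R grad \<rho> x"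
        unfolding a_def by (rule grad_flat_compose(2)[OF D(6)[OF True]])
      finally have "s n x = a n x * divg H x - n * flat 2 (- real n * \<rho> x) * \<Phi> x" by (simp add: \<Phi>_def)
      moreover have "a n x = 0" "flat 2 (- real n * \<rho> x) = 0" if "x \<notin> G"
        using D(5)[OF True] that by (auto simp: a_def intro!: flat_eq_0)
      ultimately show ?thesis by (auto simp: indicator_def)
    next
      case False
      then have x: "x \<notin> cball p r" using KU by auto
      then show ?thesis
        using divg_zero_off[OF closed_cball aH0 x] divg_zero_off[OF closed_cball K x] K[OF x]
        by (simp add: s_def \<Phi>_def)
    qed
    have "Ck_on 0 UNIV (divg H)" using H by (intro Ck_on_divg) auto
    then have cont: "continuous_on UNIV (divg H)" by simp
    then have [measurable]: "divg H \<in> borel_measurable borel" by (intro borel_measurable_continuous_onI)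
    have "Ck_on 0 UNIV (s n)" for n unfolding s_def[abs_def] using aH by (intro Ck_on_divg) auto
    then have [measurable]: "s n \<in> borel_measurable borel" for n by (auto intro: borel_measurable_continuous_onI)
    have [measurable]: "G \<in> sets borel" using G(1) by simp
    have dH0: "divg H x = 0" if "x \<notin> cball p r" for x by (rule divg_zero_off[OF closed_cball K that])
    obtain B where B: "B > 0" "\<And>x. norm (divg H x) \<le> B"
      using continuous_compact_support_bounded[OF cont compact_cball dH0] by metis
    \<comment> \<open>This one estimate gives both the uniform bound, since \<open>flat 1\<close> is
      at most 1, and the pointwise limit 0, since \<open>flat 1\<close> tends to 0 at
      infinity.\<close>
    have err: "\<bar>n * flat 2 (- real n * \<rho> x) * \<Phi> x\<bar> \<le> C * flat 1 (n * \<bar>\<rho> x\<bar>)" if "x \<in> G" "x \<in> cball p r" for n x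
    proof -
      have neg: "\<rho> x < 0" using D(5)[of x] that KU by auto
      have "\<bar>n * flat 2 (- real n * \<rho> x) * \<Phi> x\<bar> = n * flat 2 (n * \<bar>\<rho> x\<bar>) * \<bar>\<Phi> x\<bar>"
        using neg by (simp add: abs_mult flat_def)
      also have "\<dots> \<le> n * flat 2 (n * \<bar>\<rho> x\<bar>) * (C * \<bar>\<rho> x\<bar>)"
        by (intro mult_left_mono \<Phi> that(1)) (simp add: flat_def)
      also have "\<dots> = C * ((n * \<bar>\<rho> x\<bar>) * flat 2 (n * \<bar>\<rho> x\<bar>))" by (simp add: mult_ac)
      finally show ?thesis by (simp only: flat_2)
    qed
    have "(\<lambda>n. LINT x|lborel. s n x) \<longlonglongrightarrow> (LINT x|lborel. indicator G x * divg H x)"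
    proof (rule integral_dominated_convergence)
      show "integrable lborel (\<lambda>x. indicator (cball p r) x * (B + C))"
        by (intro integrable_mult_left integrable_real_indicator emeasure_compact_finite) auto
      show "AE x in lborel. norm (s n x) \<le> indicator (cball p r) x * (B + C)" for n
      proof (rule AE_I2)
        fix x
        show "norm (s n x) \<le> indicator (cball p r) x * (B + C)"
        proof (cases "x \<in> G \<and> x \<in> cball p r")
          case True
          have "norm (s n x) \<le> \<bar>a n x * divg H x\<bar> + \<bar>n * flat 2 (- real n * \<rho> x) * \<Phi> x\<bar>"
            using True by (simp add: s_eq)
          also have "\<dots> \<le> 1 * B + C * 1"
          proof (intro add_mono)
            show "\<bar>a n x * divg H x\<bar> \<le> 1 * B" unfolding abs_mult
              using B(2)[of x] flat_0_le_1 by (intro mult_mono) (auto simp: a_def)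
            have "\<bar>n * flat 2 (- real n * \<rho> x) * \<Phi> x\<bar> \<le> C * flat 1 (n * \<bar>\<rho> x\<bar>)" by (rule err) (use True in auto)
            also have "\<dots> \<le> C * 1" by (intro mult_left_mono flat_1_le_1 C0)
            finally show "\<bar>n * flat 2 (- real n * \<rho> x) * \<Phi> x\<bar> \<le> C * 1" .
          qed
          finally show ?thesis using True by simp
        next
          case False
          then have "s n x = 0" using dH0[of x] K[of x] by (auto simp: s_eq \<Phi>_def)
          then show ?thesis using B(1) C0 by simp
        qed
      qed
      show "AE x in lborel. (\<lambda>n. s n x) \<longlonglongrightarrow> indicator G x * divg H x"
      proof (rule AE_I2)
        fix x
        show "(\<lambda>n. s n x) \<longlonglongrightarrow> indicator G x * divg H x"
        proof (cases "x \<in> G \<and> x \<in> cball p r")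
          case True
          then have neg: "\<rho> x < 0" using D(5)[of x] KU by auto
          have lim: "filterlim (\<lambda>n. real n * \<bar>\<rho> x\<bar>) at_top sequentially"
            using neg by (intro filterlim_at_top_mult_tendsto_pos[OF tendsto_const] filterlim_real_sequentially) auto
          have "(\<lambda>n. a n x) \<longlonglongrightarrow> 1"
            using filterlim_compose[OF flat_0_at_top lim] neg by (simp add: a_def)
          moreover have "(\<lambda>n. n * flat 2 (- real n * \<rho> x) * \<Phi> x) \<longlonglongrightarrow> 0"
          proof (rule Lim_null_comparison)
            show "eventually (\<lambda>n. norm (n * flat 2 (- real n * \<rho> x) * \<Phi> x) \<le> C * flat 1 (n * \<bar>\<rho> x\<bar>)) sequentially"
              using err True by (intro always_eventually) auto
            show "(\<lambda>n. C * flat 1 (n * \<bar>\<rho> x\<bar>)) \<longlonglongrightarrow> 0"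
              by (intro tendsto_mult_right_zero filterlim_compose[OF flat_1_at_top lim])
          qed
          ultimately have "(\<lambda>n. a n x * divg H x - n * flat 2 (- real n * \<rho> x) * \<Phi> x) \<longlonglongrightarrow> 1 * divg H x - 0"
            by (intro tendsto_intros)
          then show ?thesis using True by (simp add: s_eq)
        next
          case False
          then show ?thesis using dH0[of x] K[of x] by (auto simp: s_eq \<Phi>_def)
        qed
      qed
    qed (simp_all add: borel_measurable_times borel_measurable_indicator)
    then have "(LINT x|lborel. indicator G x * divg H x) = 0" by (simp add: s_int LIMSEQ_const_iff)
    then show "(LINT x|lebesgue_on G. divg H x) = 0" by (subst integral_lebesgue_on_open[OF G(1)]) auto
  qed
qed

section \<open>From local to global by a finite cover\<close>

text \<open>The value must be exactly 1 on the smaller ball, so that multiplication by 1 - b removes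
  that ball from the support of a field.\<close>

lemma smooth_bump:
  fixes p :: "'a::euclidean_space"
  assumes "r > 0"
  obtains b :: "'a \<Rightarrow> real" where "\<And>n. Ck_on n UNIV b" "\<And>x. x \<in> cball p (r / 2) \<Longrightarrow> b x = 1"
    "\<And>x. x \<notin> cball p r \<Longrightarrow> b x = 0"
proof -
  define c where "c = flat 0 1"
  have c: "c > 0" by (simp add: c_def flat_pos)
  \<comment> \<open>The scaling makes \<open>u\<close> at most 1/2 on the inner ball and larger than
    2 off the outer one, leaving a gap around the thresholds 1 and 2 used below.\<close>
  define u where "u = (\<lambda>x. 2 / r\<^sup>2 * ((x - p) \<bullet> (x - p)))"
  \<comment> \<open>The inner \<open>flat\<close> is at least \<open>c\<close> where \<open>u \<le> 1\<close> and zero where \<open>u \<ge> 2\<close>; the outer one makes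
    \<open>b\<close> exactly constant on both regions.\<close>
  define b where "b = (\<lambda>x. 1 + (- 1 / flat 0 c) * flat 0 (c + (- 1) * flat 0 (2 + (- 1) * u x)))"
  have "Ck_on n UNIV (\<lambda>x. x + (- p))" for n
    by (rule Ck_on_add[OF open_UNIV Ck_on_linear[OF bounded_linear_ident] Ck_on_const]) auto
  then have x: "Ck_on n UNIV (\<lambda>x. x - p)" for n by simp
  have u: "Ck_on n UNIV u" for n unfolding u_def
    by (rule Ck_on_mult[OF open_UNIV Ck_on_const[OF open_UNIV] Ck_on_inner[OF open_UNIV x x]])
  have aff: "Ck_on n UNIV (\<lambda>x. s + t * f x)" if "Ck_on n UNIV f" for n s t and f :: "'a \<Rightarrow> real"
    by (rule Ck_on_add[OF open_UNIV Ck_on_const[OF open_UNIV] Ck_on_mult[OF open_UNIV Ck_on_const[OF open_UNIV] that]])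
  have smooth: "Ck_on n UNIV b" for n unfolding b_def
    by (rule aff Ck_on_compose_real[OF open_UNIV Ck_on_flat] u)+
  have dist2: "(x - p) \<bullet> (x - p) = (dist p x)\<^sup>2" for x
    by (simp add: dot_square_norm dist_norm norm_minus_commute)
  show thesis
  proof (rule that[OF smooth])
    fix x assume "x \<in> cball p (r / 2)"
    then have "(dist p x)\<^sup>2 \<le> (r / 2)\<^sup>2" by (intro power_mono) auto
    then have "4 * (dist p x)\<^sup>2 \<le> r\<^sup>2" by (simp add: power_divide)
    moreover have "0 \<le> (dist p x)\<^sup>2" by simp
    ultimately have "2 * (dist p x)\<^sup>2 \<le> r\<^sup>2" by linarith
    then have "u x \<le> 1" using assms by (simp add: u_def dist2 field_simps)
    then have "c \<le> flat 0 (2 - u x)" unfolding c_def by (intro flat_0_mono) auto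
    then show "b x = 1" by (simp add: b_def flat_eq_0)
  next
    fix x assume "x \<notin> cball p r"
    then have "r\<^sup>2 \<le> (dist p x)\<^sup>2" using assms by (intro power_mono) auto
    then have "u x \<ge> 2" using assms by (simp add: u_def dist2 field_simps)
    then have "flat 0 (2 - u x) = 0" by (intro flat_eq_0) auto
    then show "b x = 0" using flat_pos[OF c, of 0] by (simp add: b_def)
  qed
qed

text \<open>Multiplication by a scalar function preserves tangency. Splitting \<open>H\<close> into
  b H and (1 - b) H peels one ball off a finite cover: the first piece is covered by the local
  result, the second is supported, within the closure, in the remaining balls.\<close>

theorem divergence_theorem_tangential:
  assumes G: "smooth_bounded_domain G" and H: "Ck_on 1 UNIV H"
    and tang: "\<And>x. x \<in> frontier G \<Longrightarrow> unit_normal G x \<bullet> H x = 0"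
  shows "(LINT x|lebesgue_on G. divg H x) = 0"
proof -
  have oG: "open G" and bG: "bounded G"
    and lG: "\<And>p. p \<in> frontier G \<Longrightarrow> \<exists>U \<rho>. local_defining_function G p U \<rho>"
    using G by (auto simp: smooth_bounded_domain_def)
  define tg where "tg = (\<lambda>H::field3. Ck_on 1 UNIV H \<and> (\<forall>x\<in>frontier G. unit_normal G x \<bullet> H x = 0))"
  have "\<exists>r>0. \<forall>H. tg H \<longrightarrow> (\<forall>x. x \<notin> cball p r \<longrightarrow> H x = 0) \<longrightarrow> (LINT x|lebesgue_on G. divg H x) = 0"
    if p: "p \<in> closure G" for p
  proof (cases "p \<in> G")
    case True
    then obtain r where "r > 0" "cball p r \<subseteq> G" using oG open_contains_cball by blast
    then show ?thesis
      using divergence_theorem_interior[OF oG _ compact_cball[of p r]] by (auto simp: tg_def)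
  next
    case False
    then have fp: "p \<in> frontier G" using p oG by (simp add: frontier_def interior_open)
    then obtain U \<rho> where l: "local_defining_function G p U \<rho>" using lG by blast
    show ?thesis
    proof (rule divergence_theorem_at_frontier[OF l oG fp])
      fix r :: real assume "r > 0" "\<And>H. Ck_on 1 UNIV H \<Longrightarrow>
        (\<And>x. x \<in> frontier G \<Longrightarrow> unit_normal G x \<bullet> H x = 0) \<Longrightarrow>
        (\<And>x. x \<notin> cball p r \<Longrightarrow> H x = 0) \<Longrightarrow> (LINT x|lebesgue_on G. divg H x) = 0"
      then show ?thesis by (intro exI[of _ r]) (simp add: tg_def)
    qed
  qed
  then have "\<forall>p\<in>closure G. \<exists>r>0. \<forall>H. tg H \<longrightarrow> (\<forall>x. x \<notin> cball p r \<longrightarrow> H x = 0) \<longrightarrow>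
      (LINT x|lebesgue_on G. divg H x) = 0" by blast
  from bchoice[OF this] obtain r where r: "\<And>p. p \<in> closure G \<Longrightarrow> r p > 0"
    and loc: "\<And>p H. p \<in> closure G \<Longrightarrow> tg H \<Longrightarrow> (\<And>x. x \<notin> cball p (r p) \<Longrightarrow> H x = 0) \<Longrightarrow>
      (LINT x|lebesgue_on G. divg H x) = 0" by blast
  have cpt: "compact (closure G)" using bG by simp
  \<comment> \<open>The cover uses the half radii, where the bump equals 1; the local result allows
    supports in the full balls.\<close>
  have cov: "closure G \<subseteq> (\<Union>p\<in>closure G. ball p (r p / 2))"
  proof
    fix p assume "p \<in> closure G"
    moreover from this have "p \<in> ball p (r p / 2)" using r[of p] by simp
    ultimately show "p \<in> (\<Union>p\<in>closure G. ball p (r p / 2))" by (rule UN_I)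
  qed
  have op: "open (ball p (r p / 2))" for p by simp
  obtain P where P: "P \<subseteq> closure G" "finite P" "closure G \<subseteq> (\<Union>p\<in>P. ball p (r p / 2))"
    using op cov by (rule compactE_image[OF cpt, of "closure G" "\<lambda>p. ball p (r p / 2)"])
  \<comment> \<open>Generalised over the field and over the finite family. The support is
    constrained only on the closure of \<open>G\<close>; with no balls left, the field vanishes on
    the open set \<open>G\<close> and so does its divergence there.\<close>
  have "(LINT x|lebesgue_on G. divg H x) = 0"
    if "finite P" "P \<subseteq> closure G" "tg H" "\<And>x. x \<in> closure G \<Longrightarrow> H x \<noteq> 0 \<Longrightarrow> x \<in> (\<Union>p\<in>P. ball p (r p / 2))"
    for P and H :: field3
    using that
  proof (induction P arbitrary: H rule: finite_induct)
    case empty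
    have z: "divg H x = 0" if x: "x \<in> G" for x
    proof -
      have H0: "0 = H y" if "y \<in> G" for y
        using empty.prems(3)[of y] that closure_subset[of G] by auto
      have "((\<lambda>x. 0) has_derivative (\<lambda>h. 0)) (at x)" by simp
      then have "(H has_derivative (\<lambda>h. 0)) (at x)"
        by (rule has_derivative_transform_within_open[OF _ oG x H0])
      then show ?thesis using frechet_derivative_at[of H "\<lambda>h. 0" x] by (simp add: divg_def fun_eq_iff)
    qed
    have "(LINT x|lebesgue_on G. divg H x) = (LINT x|lebesgue_on G. 0)"
      by (rule Bochner_Integration.integral_cong) (use z in auto)
    then show ?case by simp
  next
    case (insert p P)
    have p: "p \<in> closure G" using insert.prems by auto
    obtain b :: "real^3 \<Rightarrow> real" where b: "\<And>n. Ck_on n UNIV b" "\<And>x. x \<in> cball p (r p / 2) \<Longrightarrow> b x = 1"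
      "\<And>x. x \<notin> cball p (r p) \<Longrightarrow> b x = 0" using smooth_bump[OF r[OF p], of p] by blast
    have H: "Ck_on 1 UNIV H" using insert.prems by (simp add: tg_def)
    have b': "Ck_on 1 UNIV (\<lambda>x. 1 + (- 1) * b x)"
      by (rule Ck_on_add[OF open_UNIV Ck_on_const[OF open_UNIV] Ck_on_mult[OF open_UNIV Ck_on_const[OF open_UNIV] b(1)]])
    define H1 where "H1 = (\<lambda>x. b x *\<^sub>R H x)"
    define H2 where "H2 = (\<lambda>x. (1 + (- 1) * b x) *\<^sub>R H x)"
    have C1: "Ck_on 1 UNIV H1" "Ck_on 1 UNIV H2" unfolding H1_def H2_def
      by (rule Ck_on_scaleR[OF open_UNIV b(1) H] Ck_on_scaleR[OF open_UNIV b' H])+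
    have t: "tg H1" "tg H2" using C1 insert.prems by (auto simp: tg_def H1_def H2_def)
    have i1: "(LINT x|lebesgue_on G. divg H1 x) = 0"
      using b(3) by (intro loc[OF p t(1)]) (auto simp: H1_def)
    have i2: "(LINT x|lebesgue_on G. divg H2 x) = 0"
    proof (rule insert.IH)
      fix x assume x: "x \<in> closure G" "H2 x \<noteq> 0"
      then have "x \<notin> ball p (r p / 2)" using b(2)[of x] by (auto simp: H2_def)
      moreover have "H x \<noteq> 0" using x by (auto simp: H2_def)
      ultimately show "x \<in> (\<Union>p\<in>P. ball p (r p / 2))" using insert.prems(3)[OF x(1)] by auto
    qed (use insert.prems t in auto)
    have d: "b differentiable (at x)" "H differentiable (at x)" "(\<lambda>x. 1 + (- 1) * b x) differentiable (at x)" for x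
      using Ck_on_1_differentiable[OF b(1)] Ck_on_1_differentiable[OF H] Ck_on_1_differentiable[OF b'] by auto
    have g: "grad (\<lambda>x. 1 + (- 1) * b x) x = - grad b x" for x
    proof -
      have "((\<lambda>x. 1 + (- 1) * b x) has_derivative (\<lambda>t. 0 + (- 1) * (grad b x \<bullet> t))) (at x)"
        by (intro has_derivative_add has_derivative_const has_derivative_mult_right has_derivative_grad d)
      from frechet_derivative_at[OF this, symmetric] show ?thesis
        by (subst grad_def) (simp add: vec_eq_iff inner_axis)
    qed
    have eq: "divg H x = divg H1 x + divg H2 x" for x
      unfolding H1_def H2_def divg_scaleR[OF d(1,2)] divg_scaleR[OF d(3,2)] g by (simp add: algebra_simps)
    have "Ck_on 0 UNIV (divg H1)" "Ck_on 0 UNIV (divg H2)" using C1 by (auto intro!: Ck_on_divg simp del: Ck_on.simps)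
    then have "integrable (lebesgue_on G) (divg H1)" "integrable (lebesgue_on G) (divg H2)"
      by (auto intro: integrable_lebesgue_on_continuous[OF oG bG])
    then show ?case using i1 i2 by (simp add: eq)
  qed
  moreover have "tg H" using H tang by (simp add: tg_def del: Ck_on.simps)
  ultimately show ?thesis using P by blast
qed

section \<open>Square integrable fields\<close>

lemma L2_I:
  "f \<in> borel_measurable (lebesgue_on G) \<Longrightarrow> integrable (lebesgue_on G) (\<lambda>x. (norm (f x))\<^sup>2) \<Longrightarrow> f \<in> L2 G"
  by (simp add: L2_def)

lemma L2_measurable[measurable_dest]: "f \<in> L2 G \<Longrightarrow> f \<in> borel_measurable (lebesgue_on G)"
  by (simp add: L2_def)

lemma L2_integrable_square: "f \<in> L2 G \<Longrightarrow> integrable (lebesgue_on G) (\<lambda>x. (norm (f x))\<^sup>2)"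
  by (simp add: L2_def)

lemma L2_scaleR:
  assumes "f \<in> L2 G"
  shows "(\<lambda>x. c *\<^sub>R f x) \<in> L2 G"
  using assms by (intro L2_I) (auto simp: L2_def power_mult_distrib)

lemma L2_zero: "(\<lambda>x. 0) \<in> L2 G"
  by (simp add: L2_def)

lemma L2_add:
  assumes f: "f \<in> L2 G" and g: "g \<in> L2 G"
  shows "(\<lambda>x. f x + g x) \<in> L2 G"
proof (rule L2_I)
  note [measurable] = L2_measurable[OF f] L2_measurable[OF g]
  show "(\<lambda>x. f x + g x) \<in> borel_measurable (lebesgue_on G)" by measurable
  have "norm ((norm (f x + g x))\<^sup>2) \<le> norm (2 * (norm (f x))\<^sup>2 + 2 * (norm (g x))\<^sup>2)" for x
  proof -
    have "(norm (f x + g x))\<^sup>2 \<le> (norm (f x) + norm (g x))\<^sup>2"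
      by (intro power_mono norm_triangle_ineq) auto
    also have "\<dots> \<le> 2 * (norm (f x))\<^sup>2 + 2 * (norm (g x))\<^sup>2" 
      using sum_squares_bound[of "norm (f x)" "norm (g x)"] by (simp add: power2_sum)
    finally show ?thesis by simp
  qed
  then have bd: "AE x in lebesgue_on G. norm ((norm (f x + g x))\<^sup>2) \<le> norm (2 * (norm (f x))\<^sup>2 + 2 * (norm (g x))\<^sup>2)"
    by (rule AE_I2)
  have "integrable (lebesgue_on G) (\<lambda>x. 2 * (norm (f x))\<^sup>2 + 2 * (norm (g x))\<^sup>2)"
    using L2_integrable_square[OF f] L2_integrable_square[OF g] by simp
  moreover have "(\<lambda>x. (norm (f x + g x))\<^sup>2) \<in> borel_measurable (lebesgue_on G)" by measurable
  ultimately show "integrable (lebesgue_on G) (\<lambda>x. (norm (f x + g x))\<^sup>2)"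
    using bd by (rule Bochner_Integration.integrable_bound)
qed

lemma L2_diff: "f \<in> L2 G \<Longrightarrow> g \<in> L2 G \<Longrightarrow> (\<lambda>x. f x - g x) \<in> L2 G"
  using L2_add[of f G "\<lambda>x. (- 1) *\<^sub>R g x"] L2_scaleR[of g G "- 1"] by simp

lemma L2_sum: "(\<And>i. i \<in> I \<Longrightarrow> f i \<in> L2 G) \<Longrightarrow> (\<lambda>x. \<Sum>i\<in>I. f i x) \<in> L2 G"
  by (induction I rule: infinite_finite_induct) (auto intro: L2_zero L2_add)

lemma L2_inner_integrable:
  assumes f: "f \<in> L2 G" and g: "g \<in> L2 G"
  shows "integrable (lebesgue_on G) (\<lambda>x. f x \<bullet> g x)"
proof (rule Bochner_Integration.integrable_bound[where f="\<lambda>x. (norm (f x))\<^sup>2 + (norm (g x))\<^sup>2"])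
  note [measurable] = L2_measurable[OF f] L2_measurable[OF g]
  show "(\<lambda>x. f x \<bullet> g x) \<in> borel_measurable (lebesgue_on G)" by measurable
  show "integrable (lebesgue_on G) (\<lambda>x. (norm (f x))\<^sup>2 + (norm (g x))\<^sup>2)"
    by (intro Bochner_Integration.integrable_add L2_integrable_square f g)
  have "norm (f x \<bullet> g x) \<le> norm ((norm (f x))\<^sup>2 + (norm (g x))\<^sup>2)" for x
  proof -
    have "\<bar>f x \<bullet> g x\<bar> \<le> norm (f x) * norm (g x)" by (rule Cauchy_Schwarz_ineq2)
    also have "\<dots> \<le> 2 * norm (f x) * norm (g x)" by simp
    also have "\<dots> \<le> (norm (f x))\<^sup>2 + (norm (g x))\<^sup>2" by (rule sum_squares_bound)
    finally show ?thesis by simp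
  qed
  then show "AE x in lebesgue_on G. norm (f x \<bullet> g x) \<le> norm ((norm (f x))\<^sup>2 + (norm (g x))\<^sup>2)" by simp
qed

lemma L2_inner_commute: "L2_inner G f g = L2_inner G g f"
  by (simp add: L2_inner_def inner_commute)

lemma L2_inner_add_left:
  "f \<in> L2 G \<Longrightarrow> g \<in> L2 G \<Longrightarrow> h \<in> L2 G \<Longrightarrow> L2_inner G (\<lambda>x. f x + g x) h = L2_inner G f h + L2_inner G g h"
  by (simp add: L2_inner_def inner_add_left L2_inner_integrable)

lemma L2_inner_add_right:
  "f \<in> L2 G \<Longrightarrow> g \<in> L2 G \<Longrightarrow> h \<in> L2 G \<Longrightarrow> L2_inner G h (\<lambda>x. f x + g x) = L2_inner G h f + L2_inner G h g"
  by (simp add: L2_inner_def inner_add_right L2_inner_integrable)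

lemma L2_inner_diff_left:
  "f \<in> L2 G \<Longrightarrow> g \<in> L2 G \<Longrightarrow> h \<in> L2 G \<Longrightarrow> L2_inner G (\<lambda>x. f x - g x) h = L2_inner G f h - L2_inner G g h"
  by (simp add: L2_inner_def inner_diff_left L2_inner_integrable)

lemma L2_inner_scaleR_left: "L2_inner G (\<lambda>x. c *\<^sub>R f x) h = c * L2_inner G f h"
  by (simp add: L2_inner_def)

lemma L2_inner_scaleR_right: "L2_inner G h (\<lambda>x. c *\<^sub>R f x) = c * L2_inner G h f"
  by (simp add: L2_inner_def)

lemma L2_inner_sum_left:
  assumes "\<And>i. i \<in> I \<Longrightarrow> f i \<in> L2 G" "h \<in> L2 G"
  shows "L2_inner G (\<lambda>x. \<Sum>i\<in>I. f i x) h = (\<Sum>i\<in>I. L2_inner G (f i) h)"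
  unfolding L2_inner_def inner_sum_left
  by (rule Bochner_Integration.integral_sum) (rule L2_inner_integrable[OF assms])

lemma L2_inner_self: "L2_inner G f f = (LINT x|lebesgue_on G. (norm (f x))\<^sup>2)"
  by (simp add: L2_inner_def dot_square_norm)

lemma L2_inner_self_nonneg: "0 \<le> L2_inner G f f"
  by (simp add: L2_inner_self)

lemma L2_norm_power2: "(L2_norm G f)\<^sup>2 = L2_inner G f f"
  by (simp add: L2_norm_def L2_inner_self_nonneg)

lemma L2_norm_nonneg: "0 \<le> L2_norm G f"
  by (simp add: L2_norm_def L2_inner_self_nonneg)

text \<open>The form is only semidefinite on functions, so a vanishing leading coefficient
  \<open>c\<close> must be treated apart: a nonnegative affine function of t has slope zero.\<close>

lemma L2_Cauchy_Schwarz: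
  assumes f: "f \<in> L2 G" and g: "g \<in> L2 G"
  shows "\<bar>L2_inner G f g\<bar> \<le> L2_norm G f * L2_norm G g"
proof -
  define a b c where "a = L2_inner G f f" and "b = L2_inner G f g" and "c = L2_inner G g g"
  have q: "0 \<le> a + 2 * t * b + t\<^sup>2 * c" for t
  proof -
    have tg: "(\<lambda>x. t *\<^sub>R g x) \<in> L2 G" by (rule L2_scaleR[OF g])
    have s: "(\<lambda>x. f x + t *\<^sub>R g x) \<in> L2 G" by (rule L2_add[OF f tg])
    have "L2_inner G (\<lambda>x. f x + t *\<^sub>R g x) (\<lambda>x. f x + t *\<^sub>R g x)
        = L2_inner G f f + t * L2_inner G f g + (t * L2_inner G g f + t * (t * L2_inner G g g))"
      by (simp add: L2_inner_add_left[OF f tg s] L2_inner_add_right[OF f tg f] L2_inner_add_right[OF f tg g]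
        L2_inner_scaleR_left L2_inner_scaleR_right distrib_left)
    also have "\<dots> = a + 2 * t * b + t\<^sup>2 * c"
      by (simp add: a_def b_def c_def L2_inner_commute[of G g f] power2_eq_square)
    finally show ?thesis by (rule subst) (rule L2_inner_self_nonneg)
  qed
  have "b\<^sup>2 \<le> a * c"
  proof (cases "c = 0")
    case True
    have "b = 0"
    proof (rule ccontr)
      assume "b \<noteq> 0"
      \<comment> \<open>This value of t would turn a + 2 t b into -1.\<close>
      then have "2 * (- (a + 1) / (2 * b)) * b = - (a + 1)" by simp
      with q[of "- (a + 1) / (2 * b)"] True show False by simp
    qed
    then show ?thesis using True by simp
  next
    case False
    then have c: "c > 0" using L2_inner_self_nonneg[of G g] by (simp add: c_def)
    \<comment> \<open>The minimiser of the quadratic polynomial.\<close>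
    from q[of "- b / c"] have "0 \<le> a - b\<^sup>2 / c" using c by (simp add: power2_eq_square field_simps)
    then show ?thesis using c by (simp add: field_simps)
  qed
  then have "\<bar>b\<bar> \<le> sqrt (a * c)" by (simp add: real_le_rsqrt)
  then show ?thesis by (simp add: L2_norm_def a_def b_def c_def real_sqrt_mult)
qed

lemma L2_inner_cong_AE:
  assumes "f \<in> L2 G" "f' \<in> L2 G" "g \<in> L2 G" "g' \<in> L2 G"
    and "AE x in lebesgue_on G. f x = f' x" "AE x in lebesgue_on G. g x = g' x"
  shows "L2_inner G f g = L2_inner G f' g'"
  unfolding L2_inner_def
proof (rule integral_cong_AE)
  note [measurable] = assms(1-4)[THEN L2_measurable]
  show "(\<lambda>x. f x \<bullet> g x) \<in> borel_measurable (lebesgue_on G)" "(\<lambda>x. f' x \<bullet> g' x) \<in> borel_measurable (lebesgue_on G)"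
    by measurable
  show "AE x in lebesgue_on G. f x \<bullet> g x = f' x \<bullet> g' x" using assms(5,6) by eventually_elim simp
qed

lemma L2_inner_self_eq_0:
  assumes "f \<in> L2 G" "L2_inner G f f = 0"
  shows "AE x in lebesgue_on G. f x = 0"
proof -
  have "AE x in lebesgue_on G. (norm (f x))\<^sup>2 = 0"
    using assms by (subst integral_nonneg_eq_0_iff_AE[symmetric]) (auto simp: L2_inner_self L2_integrable_square)
  then show ?thesis by simp
qed

lemma L2_sums_inner:
  assumes s: "L2_sums G f u" and g: "g \<in> L2 G"
  shows "(\<lambda>n. \<Sum>j<n. L2_inner G (f j) g) \<longlonglongrightarrow> L2_inner G u g"
proof -
  have f: "\<And>j. f j \<in> L2 G" and u: "u \<in> L2 G"
    and lim: "(\<lambda>n. L2_norm G (\<lambda>x. (\<Sum>j<n. f j x) - u x)) \<longlonglongrightarrow> 0"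
    using s by (auto simp: L2_sums_def)
  have S: "(\<lambda>x. \<Sum>j<n. f j x) \<in> L2 G" for n by (rule L2_sum) (rule f)
  have "(\<lambda>n. (\<Sum>j<n. L2_inner G (f j) g) - L2_inner G u g) \<longlonglongrightarrow> 0"
  proof (rule Lim_null_comparison)
    have "norm ((\<Sum>j<n. L2_inner G (f j) g) - L2_inner G u g) \<le> L2_norm G (\<lambda>x. (\<Sum>j<n. f j x) - u x) * L2_norm G g" for n
    proof -
      have "(\<Sum>j<n. L2_inner G (f j) g) - L2_inner G u g = L2_inner G (\<lambda>x. (\<Sum>j<n. f j x) - u x) g"
        by (simp add: L2_inner_diff_left[OF S u g] L2_inner_sum_left f g)
      then show ?thesis using L2_Cauchy_Schwarz[OF L2_diff[OF S u] g, of n] by simp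
    qed
    then show "\<forall>\<^sub>F n in sequentially. norm ((\<Sum>j<n. L2_inner G (f j) g) - L2_inner G u g)
        \<le> L2_norm G (\<lambda>x. (\<Sum>j<n. f j x) - u x) * L2_norm G g" by simp
    show "(\<lambda>n. L2_norm G (\<lambda>x. (\<Sum>j<n. f j x) - u x) * L2_norm G g) \<longlonglongrightarrow> 0"
      using lim by (rule tendsto_mult_left_zero)
  qed
  then show ?thesis by (simp add: LIM_zero_iff)
qed

lemma L2_sums_unique_AE:
  assumes "L2_sums G f u" "L2_sums G f u'"
  shows "AE x in lebesgue_on G. u x = u' x"
proof -
  have L: "u \<in> L2 G" "u' \<in> L2 G" using assms by (auto simp: L2_sums_def)
  define d where "d = (\<lambda>x. u x - u' x)"
  have d: "d \<in> L2 G" unfolding d_def by (rule L2_diff[OF L])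
  have "L2_inner G u d = L2_inner G u' d"
    by (rule LIMSEQ_unique[OF L2_sums_inner[OF assms(1) d] L2_sums_inner[OF assms(2) d]])
  then have "L2_inner G d d = 0"
    using L2_inner_diff_left[OF L d] by (simp add: d_def)
  from L2_inner_self_eq_0[OF d this] show ?thesis by (simp add: d_def)
qed

section \<open>Completeness and orthogonal series\<close>

text \<open>Cauchy-Schwarz against the constant 1, which is square integrable because
  \<open>G\<close> is bounded.\<close>

lemma integrable_L2:
  assumes G: "open G" "bounded G" and f: "f \<in> L2 G"
  shows "integrable (lebesgue_on G) f"
    and "(LINT x|lebesgue_on G. norm (f x)) \<le> sqrt (measure lebesgue G) * L2_norm G f"
proof -
  have lm: "G \<in> lmeasurable" using G by (intro lmeasurable_open)
  then have fin: "integrable (lebesgue_on G) (\<lambda>x. 1::real)"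
    by (simp add: integrable_restrict_space lmeasurable_iff_integrable fmeasurableD)
  note [measurable] = L2_measurable[OF f]
  have nf: "(\<lambda>x. norm (f x)) \<in> L2 G" by (intro L2_I) (use f in \<open>auto simp: L2_integrable_square\<close>)
  have one: "(\<lambda>x. 1::real) \<in> L2 G" by (intro L2_I) (auto simp: fin)
  have "integrable (lebesgue_on G) (\<lambda>x. norm (f x))" using L2_inner_integrable[OF nf one] by simp
  then show "integrable (lebesgue_on G) f" by (rule integrable_norm_cancel) measurable
  have "L2_norm G (\<lambda>x. 1::real) = sqrt (measure lebesgue G)"
    using lm by (simp add: L2_norm_def L2_inner_def measure_restrict_space fmeasurableD space_restrict_space)
  moreover have "L2_norm G (\<lambda>x. norm (f x)) = L2_norm G f"
    by (simp add: L2_norm_def L2_inner_self)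
  ultimately show "(LINT x|lebesgue_on G. norm (f x)) \<le> sqrt (measure lebesgue G) * L2_norm G f"
    using L2_Cauchy_Schwarz[OF nf one] by (simp add: L2_inner_def mult.commute)
qed

text \<open>Finite measure makes the sequence Cauchy in the mean, so a subsequence converges almost
  everywhere. Fatou's lemma along that subsequence then recovers the square norm estimate for the
  limit.\<close>

lemma L2_complete:
  assumes G: "open G" "bounded G" and s: "\<And>n. s n \<in> L2 G"
    and cauchy: "\<And>e. e > 0 \<Longrightarrow> \<exists>N. \<forall>i\<ge>N. \<forall>j\<ge>N. L2_norm G (\<lambda>x. s i x - s j x) < e"
  obtains u where "u \<in> L2 G" "(\<lambda>n. L2_norm G (\<lambda>x. s n x - u x)) \<longlonglongrightarrow> 0"
proof -
  let ?M = "lebesgue_on G"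
  note m[measurable] = L2_measurable[OF s]
  have d: "(\<lambda>x. s i x - s j x) \<in> L2 G" for i j by (rule L2_diff[OF s s])
  have "\<exists>N. \<forall>i\<ge>N. \<forall>j\<ge>N. (LINT x|?M. norm (s i x - s j x)) < e" if "e > 0" for e
  proof -
    define c where "c = sqrt (measure lebesgue G) + 1"
    have c: "c > 0" by (simp add: c_def add_nonneg_pos)
    then have "e / c > 0" using that by simp
    from cauchy[OF this] obtain N where N: "\<And>i j. i \<ge> N \<Longrightarrow> j \<ge> N \<Longrightarrow> L2_norm G (\<lambda>x. s i x - s j x) < e / c"
      by blast
    have "(LINT x|?M. norm (s i x - s j x)) < e" if ij: "i \<ge> N" "j \<ge> N" for i j
    proof -
      have "(LINT x|?M. norm (s i x - s j x)) \<le> sqrt (measure lebesgue G) * L2_norm G (\<lambda>x. s i x - s j x)"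
        by (rule integrable_L2(2)[OF G d])
      also have "\<dots> \<le> c * L2_norm G (\<lambda>x. s i x - s j x)"
        by (intro mult_right_mono L2_norm_nonneg) (simp add: c_def)
      also have "\<dots> < e" using N[OF ij] c by (simp add: field_simps)
      finally show ?thesis .
    qed
    then show ?thesis by blast
  qed
  from cauchy_L1_AE_cauchy_subseq[OF integrable_L2(1)[OF G s] this]
  obtain r where r: "strict_mono r" and AE: "AE x in ?M. Cauchy (\<lambda>i. s (r i) x)" by blast
  define u where "u = (\<lambda>x. lim (\<lambda>i. s (r i) x))"
  have um[measurable]: "u \<in> borel_measurable ?M" unfolding u_def by (rule borel_measurable_lim_metric) measurable
  have lim: "AE x in ?M. (\<lambda>i. s (r i) x) \<longlonglongrightarrow> u x"
    using AE by eventually_elim (simp add: u_def Cauchy_convergent_iff convergent_LIMSEQ_iff)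
  \<comment> \<open>The index n stays fixed while the second index runs through the subsequence;
    \<open>r i \<ge> i\<close> places almost all of it beyond N.\<close>
  have fatou: "(\<integral>\<^sup>+x. ennreal ((norm (s n x - u x))\<^sup>2) \<partial>?M) \<le> ennreal (e\<^sup>2)"
    if N: "\<And>i. i \<ge> N \<Longrightarrow> L2_norm G (\<lambda>x. s n x - s i x) \<le> e" and e: "e \<ge> 0" for n N e
  proof -
    have "AE x in ?M. ennreal ((norm (s n x - u x))\<^sup>2) = liminf (\<lambda>i. ennreal ((norm (s n x - s (r i) x))\<^sup>2))"
      using lim
    proof eventually_elim
      case (elim x)
      then have "(\<lambda>i. ennreal ((norm (s n x - s (r i) x))\<^sup>2)) \<longlonglongrightarrow> ennreal ((norm (s n x - u x))\<^sup>2)"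
        by (intro tendsto_ennrealI tendsto_intros)
      then show ?case by (rule lim_imp_Liminf[OF trivial_limit_sequentially, symmetric])
    qed
    then have "(\<integral>\<^sup>+x. ennreal ((norm (s n x - u x))\<^sup>2) \<partial>?M)
        = (\<integral>\<^sup>+x. liminf (\<lambda>i. ennreal ((norm (s n x - s (r i) x))\<^sup>2)) \<partial>?M)"
      by (rule nn_integral_cong_AE)
    also have "\<dots> \<le> liminf (\<lambda>i. \<integral>\<^sup>+x. ennreal ((norm (s n x - s (r i) x))\<^sup>2) \<partial>?M)"
      by (rule nn_integral_liminf) measurable
    also have "\<dots> \<le> ennreal (e\<^sup>2)"
    proof (rule Liminf_le)
      show "eventually (\<lambda>i. (\<integral>\<^sup>+x. ennreal ((norm (s n x - s (r i) x))\<^sup>2) \<partial>?M) \<le> ennreal (e\<^sup>2)) sequentially"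
        using eventually_ge_at_top[of N]
      proof eventually_elim
        case (elim i)
        then have "r i \<ge> N" using seq_suble[OF r, of i] by linarith
        then have "(L2_norm G (\<lambda>x. s n x - s (r i) x))\<^sup>2 \<le> e\<^sup>2" by (intro power_mono N L2_norm_nonneg)
        then have "(LINT x|?M. (norm (s n x - s (r i) x))\<^sup>2) \<le> e\<^sup>2" by (simp add: L2_norm_power2 L2_inner_self)
        then show ?case
          by (subst nn_integral_eq_integral) (auto intro!: ennreal_leI L2_integrable_square[OF d])
      qed
    qed simp
    finally show ?thesis .
  qed
  have du: "(\<lambda>x. s n x - u x) \<in> L2 G \<and> L2_norm G (\<lambda>x. s n x - u x) \<le> e"
    if N: "\<And>i. i \<ge> N \<Longrightarrow> L2_norm G (\<lambda>x. s n x - s i x) \<le> e" and e: "e \<ge> 0" for n N e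
  proof -
    have i: "integrable ?M (\<lambda>x. (norm (s n x - u x))\<^sup>2)"
      using le_less_trans[OF fatou[of N n e, OF N e] ennreal_less_top]
      by (intro integrableI_bounded) auto
    then have "ennreal (LINT x|?M. (norm (s n x - u x))\<^sup>2) \<le> ennreal (e\<^sup>2)"
      using fatou[of N n e, OF N e] nn_integral_eq_integral[OF i] by simp
    then have "(L2_norm G (\<lambda>x. s n x - u x))\<^sup>2 \<le> e\<^sup>2"
      by (simp add: L2_norm_power2 L2_inner_self)
    then have "L2_norm G (\<lambda>x. s n x - u x) \<le> e" using e by (rule power2_le_imp_le)
    moreover have "(\<lambda>x. s n x - u x) \<in> L2 G" using i by (intro L2_I) measurable
    ultimately show ?thesis by simp
  qed
  show thesis
  proof (rule that[of u])
    obtain N where N: "\<And>i j. i \<ge> N \<Longrightarrow> j \<ge> N \<Longrightarrow> L2_norm G (\<lambda>x. s i x - s j x) < 1" using cauchy[OF zero_less_one] by blast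
    have "(\<lambda>x. s N x - u x) \<in> L2 G" using du[of N N 1] N[of N] by (simp add: less_imp_le)
    from L2_diff[OF s[of N] this] show "u \<in> L2 G" by simp
    show "(\<lambda>n. L2_norm G (\<lambda>x. s n x - u x)) \<longlonglongrightarrow> 0"
    proof (rule LIMSEQ_I)
      fix e :: real assume e: "e > 0"
      obtain N where N: "\<And>i j. i \<ge> N \<Longrightarrow> j \<ge> N \<Longrightarrow> L2_norm G (\<lambda>x. s i x - s j x) < e / 2"
        using cauchy[OF half_gt_zero[OF e]] by blast
      have "L2_norm G (\<lambda>x. s n x - u x) < e" if "n \<ge> N" for n
        using du[of N n "e / 2"] N[OF that] e by (force simp: less_imp_le)
      then show "\<exists>N. \<forall>n\<ge>N. norm (L2_norm G (\<lambda>x. s n x - u x) - 0) < e"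
        by (intro exI[of _ N]) (simp add: L2_norm_nonneg)
    qed
  qed
qed

text \<open>By Pythagoras the squared distance of two partial sums is a block of the series of
  squared norms, so the partial sums are Cauchy.\<close>

lemma L2_orthogonal_sums:
  assumes G: "open G" "bounded G" and f: "\<And>n. f n \<in> L2 G"
    and orth: "\<And>i j. i \<noteq> j \<Longrightarrow> L2_inner G (f i) (f j) = 0"
    and sm: "summable (\<lambda>j. L2_inner G (f j) (f j))"
  obtains u where "L2_sums G f u"
proof -
  define s where "s = (\<lambda>n x. \<Sum>j<n. f j x)"
  have s: "s n \<in> L2 G" for n unfolding s_def by (rule L2_sum) (rule f)
  have diff: "(L2_norm G (\<lambda>x. s n x - s m x))\<^sup>2 = (\<Sum>j\<in>{m..<n}. L2_inner G (f j) (f j))" if "m \<le> n" for m n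
  proof -
    have e: "(\<lambda>x. s n x - s m x) = (\<lambda>x. \<Sum>j\<in>{m..<n}. f j x)"
      using that by (simp add: s_def fun_eq_iff sum_diff_nat_ivl[of 0 m n, symmetric] lessThan_atLeast0)
    have S: "(\<lambda>x. \<Sum>j\<in>{m..<n}. f j x) \<in> L2 G" by (rule L2_sum) (rule f)
    have "(L2_norm G (\<lambda>x. s n x - s m x))\<^sup>2 = (\<Sum>i\<in>{m..<n}. \<Sum>j\<in>{m..<n}. L2_inner G (f j) (f i))"
      unfolding L2_norm_power2 e
      by (simp add: L2_inner_sum_left f S L2_inner_commute[of G "f _" "\<lambda>x. \<Sum>j\<in>{m..<n}. f j x"])
    also have "\<dots> = (\<Sum>i\<in>{m..<n}. L2_inner G (f i) (f i))"
    proof (rule sum.cong[OF refl])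
      fix i assume "i \<in> {m..<n}"
      then have "(\<Sum>j\<in>{m..<n}. L2_inner G (f j) (f i)) = L2_inner G (f i) (f i) + (\<Sum>j\<in>{m..<n} - {i}. L2_inner G (f j) (f i))"
        by (intro sum.remove) auto
      also have "(\<Sum>j\<in>{m..<n} - {i}. L2_inner G (f j) (f i)) = 0" by (rule sum.neutral) (auto simp: orth)
      finally show "(\<Sum>j\<in>{m..<n}. L2_inner G (f j) (f i)) = L2_inner G (f i) (f i)" by simp
    qed
    finally show ?thesis .
  qed
  have sym: "L2_norm G (\<lambda>x. s n x - s m x) = L2_norm G (\<lambda>x. s m x - s n x)" for m n
    by (simp add: L2_norm_def L2_inner_self norm_minus_commute)
  have "\<exists>N. \<forall>i\<ge>N. \<forall>j\<ge>N. L2_norm G (\<lambda>x. s i x - s j x) < e" if e: "e > 0" for e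
  proof -
    from sm e obtain N where N: "\<And>m n. m \<ge> N \<Longrightarrow> norm (\<Sum>j\<in>{m..<n}. L2_inner G (f j) (f j)) < e\<^sup>2"
      unfolding summable_Cauchy by (meson zero_less_power)
    have *: "L2_norm G (\<lambda>x. s i x - s j x) < e" if "N \<le> j" "j \<le> i" for i j
    proof -
      have "(L2_norm G (\<lambda>x. s i x - s j x))\<^sup>2 < e\<^sup>2" using N[OF that(1), of i] diff[OF that(2)] by simp
      then show ?thesis using e by (simp add: power2_less_imp_less)
    qed
    have "L2_norm G (\<lambda>x. s i x - s j x) < e" if "N \<le> i" "N \<le> j" for i j
      using *[of j i] *[of i j] that sym[of i j] by (cases "j \<le> i") auto
    then show ?thesis by blast
  qed
  from L2_complete[OF G s this] obtain u where "u \<in> L2 G" "(\<lambda>n. L2_norm G (\<lambda>x. s n x - u x)) \<longlonglongrightarrow> 0" by blast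
  then have "L2_sums G f u" using f by (simp add: L2_sums_def s_def)
  then show thesis by (rule that)
qed

section \<open>Test functions are dense\<close>

lemma test_functionD:
  assumes "test_function G \<phi>"
  shows "Ck_on n UNIV \<phi>" "compact (closure {x. \<phi> x \<noteq> 0})" "closure {x. \<phi> x \<noteq> 0} \<subseteq> G"
    "x \<notin> closure {x. \<phi> x \<noteq> 0} \<Longrightarrow> \<phi> x = 0"
proof -
  show "Ck_on n UNIV \<phi>" "compact (closure {x. \<phi> x \<noteq> 0})" "closure {x. \<phi> x \<noteq> 0} \<subseteq> G"
    using assms by (auto simp: test_function_def smooth_on_def)
  show "x \<notin> closure {x. \<phi> x \<noteq> 0} \<Longrightarrow> \<phi> x = 0" using closure_subset[of "{x. \<phi> x \<noteq> 0}"] by auto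
qed

lemma test_functionI:
  assumes "\<And>n. Ck_on n UNIV \<phi>" "compact K" "K \<subseteq> G" "\<And>x. x \<notin> K \<Longrightarrow> \<phi> x = 0"
  shows "test_function G \<phi>"
proof -
  have "{x. \<phi> x \<noteq> 0} \<subseteq> K" using assms(4) by auto
  then have "closure {x. \<phi> x \<noteq> 0} \<subseteq> K" "bounded {x. \<phi> x \<noteq> 0}"
    using compact_imp_closed[OF assms(2)] compact_imp_bounded[OF assms(2)]
    by (auto intro: closure_minimal[THEN subsetD] bounded_subset)
  then show ?thesis using assms(1,3) by (auto simp: test_function_def smooth_on_def)
qed

lemma test_function_divg:
  fixes \<psi> :: field3
  assumes \<psi>: "test_function G \<psi>"
  shows "test_function G (divg \<psi>)"
proof (rule test_functionI[OF _ test_functionD(2,3)[OF \<psi>]])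
  show "Ck_on n UNIV (divg \<psi>)" for n by (intro Ck_on_divg test_functionD(1)[OF \<psi>]) auto
  show "divg \<psi> x = 0" if "x \<notin> closure {x. \<psi> x \<noteq> 0}" for x
    by (rule divg_zero_off[OF closed_closure _ that]) (rule test_functionD(4)[OF \<psi>])
qed

lemma test_function_grad:
  assumes \<phi>: "test_function G \<phi>"
  shows "test_function G (grad \<phi>)"
proof (rule test_functionI[OF _ test_functionD(2,3)[OF \<phi>]])
  show "Ck_on n UNIV (grad \<phi>)" for n by (intro Ck_on_grad test_functionD(1)[OF \<phi>]) auto
  fix x assume x: "x \<notin> closure {x. \<phi> x \<noteq> 0}"
  have "frechet_derivative \<phi> (at x) = (\<lambda>h. 0)"
    by (rule frechet_derivative_zero_off[OF closed_closure _ x]) (rule test_functionD(4)[OF \<phi>])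
  then show "grad \<phi> x = 0" by (simp add: grad_def vec_eq_iff)
qed

lemma continuous_L2:
  assumes "open G" "bounded G" "continuous_on UNIV f"
  shows "f \<in> L2 G"
proof (rule L2_I)
  show "f \<in> borel_measurable (lebesgue_on G)"
    by (rule borel_measurable_integrable[OF integrable_lebesgue_on_continuous[OF assms]])
  show "integrable (lebesgue_on G) (\<lambda>x. (norm (f x))\<^sup>2)"
    using assms by (intro integrable_lebesgue_on_continuous continuous_intros)
qed

lemma test_function_L2: "open G \<Longrightarrow> bounded G \<Longrightarrow> test_function G \<phi> \<Longrightarrow> \<phi> \<in> L2 G"
  by (intro continuous_L2 Ck_on_continuous_on[OF test_functionD(1)[of G \<phi> 0]])

section \<open>Boxes as limits of test functions, and the fundamental lemma of the calculus of
  variations\<close>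

lemma Ck_on_prod:
  fixes f :: "'i \<Rightarrow> 'a::euclidean_space \<Rightarrow> real"
  assumes "open S" "\<And>i. i \<in> I \<Longrightarrow> Ck_on n S (f i)"
  shows "Ck_on n S (\<lambda>x. \<Prod>i\<in>I. f i x)"
  using assms(2) by (induction I rule: infinite_finite_induct) (auto intro: Ck_on_mult Ck_on_const assms(1))

text \<open>A product of one-sided cutoffs, two for each coordinate. Increasing n sharpens them,
  since \<open>flat 0 (n * t)\<close> tends to 1 for t > 0 and is 0 for t \<le> 0; the limit is the
  indicator of the open box.\<close>

definition box_bump :: "real^3 \<Rightarrow> real^3 \<Rightarrow> nat \<Rightarrow> real^3 \<Rightarrow> real" where
  "box_bump a b n x = (\<Prod>i\<in>UNIV. flat 0 (real n * (x $ i - a $ i)) * flat 0 (real n * (b $ i - x $ i)))"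

lemma Ck_on_box_bump: "Ck_on m UNIV (box_bump a b n)"
proof -
  have l: "Ck_on m UNIV (\<lambda>x::real^3. x $ i)" for i by (rule Ck_on_linear[OF bounded_linear_vec_nth]) simp
  have "Ck_on m UNIV (\<lambda>x::real^3. real n * (x $ i + (- a $ i)))" for i
    by (intro Ck_on_mult Ck_on_add Ck_on_const l) auto
  then have lo: "Ck_on m UNIV (\<lambda>x. flat 0 (real n * (x $ i - a $ i)))" for i
    by (intro Ck_on_compose_real[OF open_UNIV Ck_on_flat]) simp
  have "Ck_on m UNIV (\<lambda>x::real^3. real n * (b $ i + (- 1) * x $ i))" for i
    by (intro Ck_on_mult Ck_on_add Ck_on_const l) auto
  then have hi: "Ck_on m UNIV (\<lambda>x. flat 0 (real n * (b $ i - x $ i)))" for i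
    by (intro Ck_on_compose_real[OF open_UNIV Ck_on_flat]) simp
  show ?thesis unfolding box_bump_def[abs_def]
    by (rule Ck_on_prod[OF open_UNIV Ck_on_mult[OF open_UNIV lo hi]])
qed

lemma box_bump_bounds: "0 \<le> box_bump a b n x" "box_bump a b n x \<le> 1"
  unfolding box_bump_def using flat_0_le_1
  by (auto intro!: prod_nonneg prod_le_1 mult_le_one)

lemma box_bump_eq_0: "x \<notin> box a b \<Longrightarrow> box_bump a b n x = 0"
proof -
  assume "x \<notin> box a b"
  then obtain i where "x $ i \<le> a $ i \<or> b $ i \<le> x $ i" by (auto simp: mem_box_cart not_less)
  then have "flat 0 (real n * (x $ i - a $ i)) * flat 0 (real n * (b $ i - x $ i)) = 0"
    by (auto intro!: flat_eq_0 mult_nonneg_nonpos)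
  then show ?thesis unfolding box_bump_def by (intro prod_zero) auto
qed

lemma box_bump_tendsto: "(\<lambda>n. box_bump a b n x) \<longlonglongrightarrow> indicator (box a b) x"
proof (cases "x \<in> box a b")
  case True
  have l: "(\<lambda>n. flat 0 (real n * t)) \<longlonglongrightarrow> 1" if "t > 0" for t
    by (rule filterlim_compose[OF flat_0_at_top])
       (use that in \<open>intro filterlim_at_top_mult_tendsto_pos[OF tendsto_const] filterlim_real_sequentially\<close>)
  have "(\<lambda>n. box_bump a b n x) \<longlonglongrightarrow> (\<Prod>i\<in>(UNIV::3 set). 1 * 1)"
    unfolding box_bump_def using True by (intro tendsto_prod tendsto_mult l) (auto simp: mem_box_cart)
  then show ?thesis using True by simp
qed (simp add: box_bump_eq_0)

text \<open>The bump of the second box confines the support to a compact part of \<open>G\<close>,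
  which frees the first box: it may range over all boxes of the space, a generator of the Borel
  sets.\<close>

lemma integral_box_eq_0:
  assumes G: "open G" "bounded G" and w: "w \<in> L2 G"
    and z: "\<And>\<psi>::field3. test_function G \<psi> \<Longrightarrow> L2_inner G w \<psi> = 0" and c: "cbox c d \<subseteq> G"
  shows "(LINT x|lebesgue. indicator (box a b) x * (indicator (box c d) x * w x $ i)) = 0"
proof -
  define \<phi> where "\<phi> = (\<lambda>n x. box_bump a b n x * box_bump c d n x)"
  have \<phi>b: "\<bar>\<phi> n x\<bar> \<le> 1" for n x unfolding \<phi>_def
    using box_bump_bounds by (auto simp: abs_mult intro!: mult_le_one)
  have \<phi>C: "Ck_on m UNIV (\<phi> n)" for m n unfolding \<phi>_def by (intro Ck_on_mult Ck_on_box_bump) auto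
  have [measurable]: "\<phi> n \<in> borel_measurable borel" for n
    using Ck_on_continuous_on[OF \<phi>C[of 0 n]] by (rule borel_measurable_continuous_onI)
  note [measurable] = L2_measurable[OF w]
  have wi: "integrable (lebesgue_on G) (\<lambda>x. w x $ i)"
    by (rule integrable_bounded_linear[OF bounded_linear_vec_nth integrable_L2(1)[OF G w]])
  have "(LINT x|lebesgue_on G. \<phi> n x * w x $ i) = 0" for n
  proof -
    have "test_function G (\<lambda>x. \<phi> n x *\<^sub>R axis i (1::real))"
    proof (rule test_functionI[OF _ compact_cbox c])
      show "Ck_on m UNIV (\<lambda>x. \<phi> n x *\<^sub>R axis i (1::real))" for m
        by (rule Ck_on_bounded_linear[OF bounded_linear_scaleR_left open_UNIV \<phi>C])
      show "\<phi> n x *\<^sub>R axis i (1::real) = 0" if "x \<notin> cbox c d" for x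
      proof -
        have "x \<notin> box c d" using that box_subset_cbox[of c d] by blast
        then show ?thesis by (simp add: \<phi>_def box_bump_eq_0)
      qed
    qed
    from z[OF this] show ?thesis by (simp add: L2_inner_def inner_axis mult.commute)
  qed
  moreover have "(\<lambda>n. LINT x|lebesgue_on G. \<phi> n x * w x $ i) \<longlonglongrightarrow>
      (LINT x|lebesgue_on G. indicator (box a b) x * indicator (box c d) x * w x $ i)"
  proof (rule integral_dominated_convergence[where w="\<lambda>x. \<bar>w x $ i\<bar>"])
    show "integrable (lebesgue_on G) (\<lambda>x. \<bar>w x $ i\<bar>)" using wi by simp
    have m: "(\<lambda>x. w x $ i) \<in> borel_measurable (lebesgue_on G)" using wi by (rule borel_measurable_integrable)
    have m': "f \<in> borel_measurable (lebesgue_on G)" if "f \<in> borel_measurable borel" for f :: "real^3 \<Rightarrow> real"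
      using that by (intro measurable_restrict_space1) (simp add: measurable_completion)
    show "(\<lambda>x. \<phi> n x * w x $ i) \<in> borel_measurable (lebesgue_on G)" for n
      by (intro borel_measurable_times m m') measurable
    show "(\<lambda>x. indicator (box a b) x * indicator (box c d) x * w x $ i) \<in> borel_measurable (lebesgue_on G)"
      by (intro borel_measurable_times m m') auto
    show "AE x in lebesgue_on G. (\<lambda>n. \<phi> n x * w x $ i) \<longlonglongrightarrow> indicator (box a b) x * indicator (box c d) x * w x $ i"
      unfolding \<phi>_def by (intro AE_I2 tendsto_mult box_bump_tendsto tendsto_const)
    show "AE x in lebesgue_on G. norm (\<phi> n x * w x $ i) \<le> \<bar>w x $ i\<bar>" for n
      using \<phi>b[of n] by (intro AE_I2) (simp add: abs_mult mult_left_le_one_le)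
  qed
  ultimately have "(LINT x|lebesgue_on G. indicator (box a b) x * indicator (box c d) x * w x $ i) = 0"
    by (simp add: LIMSEQ_const_iff)
  moreover have "(LINT x|lebesgue_on G. indicator (box a b) x * indicator (box c d) x * w x $ i)
      = (LINT x|lebesgue. indicator G x *\<^sub>R (indicator (box a b) x * indicator (box c d) x * w x $ i))"
    using G by (intro integral_restrict_space) auto
  moreover have "(\<lambda>x. indicator G x *\<^sub>R (indicator (box a b) x * indicator (box c d) x * w x $ i))
      = (\<lambda>x. indicator (box a b) x * (indicator (box c d) x * w x $ i))"
    using c box_subset_cbox[of c d] by (intro ext) (auto simp: indicator_def)
  ultimately show ?thesis by (simp only:)
qed

text \<open>The Borel sets over which the integral vanishes form a Dynkin system, and boxes are
  stable under intersection, so all Borel sets qualify. Lebesgue sets differ from Borel sets by null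
  sets, and an integrable function with zero integral over every measurable set vanishes almost
  everywhere.\<close>

lemma AE_0_on_box:
  fixes f :: "real^3 \<Rightarrow> real"
  assumes f: "integrable lebesgue f"
    and box: "\<And>a b. (LINT x|lebesgue. indicator (box a b) x * f x) = 0"
    and tot: "(LINT x|lebesgue. f x) = 0"
  shows "AE x in lebesgue. f x = 0"
proof (rule density_unique_real[OF f])
  have si: "set_integrable lebesgue A f" if "A \<in> sets lebesgue" for A
    using integrable_mult_indicator[OF that f] by (simp add: set_integrable_def)
  have borel: "set_lebesgue_integral lebesgue A f = 0" if "A \<in> sets borel" for A
  proof -
    let ?E = "range (\<lambda>(a, b). box a b :: (real^3) set)"
    have s: "sets borel = sigma_sets UNIV ?E" by (subst borel_eq_box) simp
    have "Int_stable ?E" by (auto simp: Int_stable_def box_Int_box)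
    moreover have "?E \<subseteq> Pow UNIV" by simp
    moreover have "A \<in> sigma_sets UNIV ?E" using that s by simp
    ultimately show ?thesis
    proof (induction A rule: sigma_sets_induct_disjoint)
      case (basic A)
      then show ?case using box by (auto simp: set_lebesgue_integral_def)
    next
      case empty
      then show ?case by (simp add: set_lebesgue_integral_def)
    next
      \<comment> \<open>Complements use the total integral \<open>tot\<close>, as the whole space is
        not itself a box.\<close>
      case (compl A)
      then have A: "A \<in> sets lebesgue" using s by simp
      then have "set_lebesgue_integral lebesgue (A \<union> (UNIV - A)) f
          = set_lebesgue_integral lebesgue A f + set_lebesgue_integral lebesgue (UNIV - A) f"
        by (intro set_integral_Un si) auto
      then show ?case using compl tot by (simp add: set_lebesgue_integral_def)
    next
      case (union A)
      then have A: "A i \<in> sets lebesgue" for i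
        using s by (metis range_subsetD sets_completionI_sets sets_lborel)
      have "set_lebesgue_integral lebesgue (\<Union>i. A i) f = (\<Sum>i. set_lebesgue_integral lebesgue (A i) f)"
        by (rule lebesgue_integral_countable_add)
           (use A union(1) in \<open>auto simp: disjoint_family_on_def intro!: si\<close>)
      then show ?case using union by simp
    qed
  qed
  show "set_lebesgue_integral lebesgue A f = set_lebesgue_integral lebesgue A (\<lambda>x. 0)"
    if A: "A \<in> sets lebesgue" for A
  proof -
    from A obtain S N N' where S: "S \<in> sets lborel" "A = S \<union> N" "N \<subseteq> N'" "N' \<in> null_sets lborel"
      by (elim sets_completionE) blast
    have "N' \<in> null_sets lebesgue" using S(4) by (rule null_sets_completionI)
    moreover have "S \<in> sets lebesgue" using S(1) by simp
    then have "(A - S) \<union> (S - A) \<in> sets lebesgue" by (intro sets.Un sets.Diff A)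
    ultimately have "(A - S) \<union> (S - A) \<in> null_sets lebesgue"
      by (rule null_sets_subset) (use S in auto)
    then have "set_lebesgue_integral lebesgue A f = set_lebesgue_integral lebesgue S f"
      using A S(1) by (intro set_integral_null_delta f) auto
    then show ?thesis using borel[of S] S(1) by simp
  qed
qed simp

text \<open>Each component is shown to vanish on closed boxes inside \<open>G\<close>; countably
  many of these exhaust \<open>G\<close>, so the exceptional null sets can be united.\<close>

theorem L2_orthogonal_test_functions_AE_0:
  assumes G: "open G" "bounded G" and w: "w \<in> L2 G"
    and z: "\<And>\<psi>::field3. test_function G \<psi> \<Longrightarrow> L2_inner G w \<psi> = 0"
  shows "AE x in lebesgue_on G. w x = 0"
proof -
  have b: "AE x in lebesgue. x \<in> cbox c d \<longrightarrow> w x $ i = 0" if c: "cbox c d \<subseteq> G" for c d i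
  proof -
    let ?f = "\<lambda>x. indicator (box c d) x * w x $ i"
    have "integrable (lebesgue_on G) (\<lambda>x. w x $ i)"
      by (rule integrable_bounded_linear[OF bounded_linear_vec_nth integrable_L2(1)[OF G w]])
    moreover have "G \<inter> space lebesgue \<in> sets lebesgue" using G by simp
    ultimately have "integrable lebesgue (\<lambda>x. indicator G x *\<^sub>R w x $ i)"
      by (simp only: integrable_restrict_space)
    moreover have "box c d \<in> sets lebesgue" by simp
    ultimately have "integrable lebesgue (\<lambda>x. indicator (box c d) x *\<^sub>R (indicator G x *\<^sub>R w x $ i))"
      by (intro integrable_mult_indicator[of "box c d"])
    moreover have "(\<lambda>x. indicator (box c d) x *\<^sub>R (indicator G x *\<^sub>R w x $ i)) = ?f"
      using c box_subset_cbox[of c d] by (intro ext) (auto simp: indicator_def)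
    ultimately have f: "integrable lebesgue ?f" by (simp only:)
    have "AE x in lebesgue. ?f x = 0"
    proof (rule AE_0_on_box[OF f])
      show box: "(LINT x|lebesgue. indicator (box a b) x * ?f x) = 0" for a b
        by (rule integral_box_eq_0[OF G w z c])
      \<comment> \<open>Choosing the test box equal to the confining box gives the total
        integral.\<close>
      have "(\<lambda>x. indicator (box c d) x * ?f x) = ?f" by (auto simp: indicator_def)
      then show "(LINT x|lebesgue. ?f x) = 0" using box[of c d] by (simp only:)
    qed
    moreover have "AE x in lebesgue. x \<notin> cbox c d - box c d"
      using negligible_frontier_interval[of c d] by (intro AE_not_in) (simp add: negligible_iff_null_sets)
    ultimately show ?thesis by eventually_elim (auto simp: indicator_def split: if_splits)
  qed
  obtain \<D> where D: "countable \<D>" "\<D> \<subseteq> Pow G" "\<And>X. X \<in> \<D> \<Longrightarrow> \<exists>a b. X = cbox a b" "\<Union>\<D> = G"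
    using open_countable_Union_open_cbox[OF G(1)] by metis
  have "AE x in lebesgue. \<forall>X\<in>\<D>. x \<in> X \<longrightarrow> w x = 0"
  proof (subst AE_ball_countable[OF D(1)], rule ballI)
    fix X assume X: "X \<in> \<D>"
    then obtain c d where "X = cbox c d" "cbox c d \<subseteq> G" using D(2,3) by blast
    then have "AE x in lebesgue. \<forall>i\<in>UNIV. x \<in> X \<longrightarrow> w x $ i = 0"
      using b by (subst AE_ball_countable) auto
    then show "AE x in lebesgue. x \<in> X \<longrightarrow> w x = 0" by eventually_elim (simp add: vec_eq_iff)
  qed
  then have "AE x in lebesgue. x \<in> G \<longrightarrow> w x = 0" by eventually_elim (use D(4) in auto)
  then show ?thesis using G by (subst AE_restrict_space_iff) auto
qed

section \<open>The distributional gradient of the divergence\<close>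

lemma L2_inner_cong:
  assumes "\<And>x. x \<in> G \<Longrightarrow> f x = f' x" "\<And>x. x \<in> G \<Longrightarrow> g x = g' x"
  shows "L2_inner G f g = L2_inner G f' g'"
  unfolding L2_inner_def by (rule Bochner_Integration.integral_cong) (use assms in auto)

text \<open>The divergence theorem for the product field P H, which is tangential as soon as one of
  the two factors kills its normal component at each frontier point.\<close>

lemma integration_by_parts:
  assumes G: "smooth_bounded_domain G" and P: "Ck_on 1 UNIV P" and H: "Ck_on 1 UNIV H"
    and b: "\<And>x. x \<in> frontier G \<Longrightarrow> P x = 0 \<or> unit_normal G x \<bullet> H x = 0"
  shows "L2_inner G (grad P) H = - L2_inner G P (divg H)"
proof -
  have oG: "open G" and bG: "bounded G" using G by (auto simp: smooth_bounded_domain_def)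
  have c: "continuous_on UNIV P" "continuous_on UNIV H"
    using Ck_on_continuous_on P H by blast+
  have "Ck_on 0 UNIV (grad P)" "Ck_on 0 UNIV (divg H)"
    by (rule Ck_on_grad[OF open_UNIV P[unfolded One_nat_def]] Ck_on_divg[OF open_UNIV H[unfolded One_nat_def]])+
  then have c': "continuous_on UNIV (grad P)" "continuous_on UNIV (divg H)" by simp_all
  have L: "P \<in> L2 G" "H \<in> L2 G" "grad P \<in> L2 G" "divg H \<in> L2 G"
    using c c' by (auto intro: continuous_L2[OF oG bG])
  have "(LINT x|lebesgue_on G. divg (\<lambda>x. P x *\<^sub>R H x) x) = 0"
    by (rule divergence_theorem_tangential[OF G Ck_on_scaleR[OF open_UNIV P H]]) (use b in auto)
  moreover have "divg (\<lambda>x. P x *\<^sub>R H x) x = grad P x \<bullet> H x + P x \<bullet> divg H x" for x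
    using divg_scaleR[OF Ck_on_1_differentiable[OF P] Ck_on_1_differentiable[OF H]] by simp
  ultimately show ?thesis
    using L2_inner_integrable[OF L(3,2)] L2_inner_integrable[OF L(1,4)] by (simp add: L2_inner_def)
qed

lemma test_function_frontier:
  assumes "open G" "test_function G \<phi>" "x \<in> frontier G"
  shows "\<phi> x = 0"
proof (rule test_functionD(4)[OF assms(2)])
  have "x \<notin> G" using assms(1,3) by (simp add: frontier_def interior_open)
  then show "x \<notin> closure {x. \<phi> x \<noteq> 0}" using test_functionD(3)[OF assms(2)] by blast
qed

lemma has_weak_grad_scaleR:
  assumes "has_weak_grad G h v"
  shows "has_weak_grad G (\<lambda>x. c *\<^sub>R h x) (\<lambda>x. c *\<^sub>R v x)"
  using assms by (auto simp: has_weak_grad_def L2_scaleR L2_inner_scaleR_left simp del: real_scaleR_def)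

lemma has_weak_grad_div_scaleR:
  assumes "has_weak_grad_div G u w"
  shows "has_weak_grad_div G (\<lambda>x. c *\<^sub>R u x) (\<lambda>x. c *\<^sub>R w x)"
  using assms by (auto simp: has_weak_grad_div_def L2_scaleR L2_inner_scaleR_left)

text \<open>Closedness of the weak gradient: for a fixed test function both sides of the defining
  identity are continuous in the square norm.\<close>

lemma has_weak_grad_sums:
  assumes G: "open G" "bounded G" and w: "\<And>j. has_weak_grad G (f j) (g j)"
    and s: "L2_sums G f u" "L2_sums G g v"
  shows "has_weak_grad G u v"
  unfolding has_weak_grad_def
proof (intro conjI allI impI)
  show "u \<in> L2 G" "v \<in> L2 G" using s by (auto simp: L2_sums_def)
  fix \<psi> :: field3 assume t: "test_function G \<psi>"
  have "(\<lambda>n. \<Sum>j<n. L2_inner G (f j) (divg \<psi>)) \<longlonglongrightarrow> L2_inner G u (divg \<psi>)"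
    by (rule L2_sums_inner[OF s(1) test_function_L2[OF G test_function_divg[OF t]]])
  moreover have "L2_inner G (f j) (divg \<psi>) = - L2_inner G (g j) \<psi>" for j
    using w[of j] t by (auto simp: has_weak_grad_def)
  ultimately have "(\<lambda>n. - (\<Sum>j<n. L2_inner G (g j) \<psi>)) \<longlonglongrightarrow> L2_inner G u (divg \<psi>)"
    by (simp add: sum_negf)
  moreover have "(\<lambda>n. - (\<Sum>j<n. L2_inner G (g j) \<psi>)) \<longlonglongrightarrow> - L2_inner G v \<psi>"
    by (intro tendsto_minus L2_sums_inner[OF s(2) test_function_L2[OF G t]])
  ultimately show "L2_inner G u (divg \<psi>) = - L2_inner G v \<psi>" by (rule LIMSEQ_unique)
qed

lemma has_weak_grad_div_sums:
  assumes G: "open G" "bounded G" and w: "\<And>j. has_weak_grad_div G (f j) (g j)"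
    and s: "L2_sums G f u" "L2_sums G g v"
  shows "has_weak_grad_div G u v"
  unfolding has_weak_grad_div_def
proof (intro conjI allI impI)
  show "u \<in> L2 G" "v \<in> L2 G" using s by (auto simp: L2_sums_def)
  fix \<psi> :: field3 assume t: "test_function G \<psi>"
  have "(\<lambda>n. \<Sum>j<n. L2_inner G (f j) (grad (divg \<psi>))) \<longlonglongrightarrow> L2_inner G u (grad (divg \<psi>))"
    by (rule L2_sums_inner[OF s(1) test_function_L2[OF G test_function_grad[OF test_function_divg[OF t]]]])
  moreover have "L2_inner G (f j) (grad (divg \<psi>)) = L2_inner G (g j) \<psi>" for j
    using w[of j] t by (auto simp: has_weak_grad_div_def)
  ultimately have "(\<lambda>n. \<Sum>j<n. L2_inner G (g j) \<psi>) \<longlonglongrightarrow> L2_inner G u (grad (divg \<psi>))"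
    by simp
  then show "L2_inner G u (grad (divg \<psi>)) = L2_inner G v \<psi>"
    by (rule LIMSEQ_unique[OF _ L2_sums_inner[OF s(2) test_function_L2[OF G t]]])
qed

text \<open>The difference of the images is orthogonal to all test functions. The arguments may
  themselves differ on a null set, so that the statement can be iterated.\<close>

lemma has_weak_grad_div_unique_AE:
  assumes G: "open G" "bounded G" and w: "has_weak_grad_div G u w" "has_weak_grad_div G u' w'"
    and u: "AE x in lebesgue_on G. u x = u' x"
  shows "AE x in lebesgue_on G. w x = w' x"
proof -
  have L: "u \<in> L2 G" "u' \<in> L2 G" "w \<in> L2 G" "w' \<in> L2 G" using w by (auto simp: has_weak_grad_div_def)
  have "AE x in lebesgue_on G. w x - w' x = 0"
  proof (rule L2_orthogonal_test_functions_AE_0[OF G L2_diff[OF L(3,4)]])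
    fix \<psi> :: field3 assume t: "test_function G \<psi>"
    have t': "grad (divg \<psi>) \<in> L2 G"
      by (rule test_function_L2[OF G test_function_grad[OF test_function_divg[OF t]]])
    have "L2_inner G w \<psi> = L2_inner G u (grad (divg \<psi>))" "L2_inner G w' \<psi> = L2_inner G u' (grad (divg \<psi>))"
      using w t by (auto simp: has_weak_grad_div_def)
    moreover have "L2_inner G u (grad (divg \<psi>)) = L2_inner G u' (grad (divg \<psi>))"
      by (rule L2_inner_cong_AE[OF L(1,2) t' t' u]) simp
    ultimately show "L2_inner G (\<lambda>x. w x - w' x) \<psi> = 0"
      by (simp add: L2_inner_diff_left[OF L(3,4) test_function_L2[OF G t]])
  qed
  then show ?thesis by simp
qed

lemma has_weak_grad_div_power_unique_AE:
  assumes G: "open G" "bounded G" and u: "AE x in lebesgue_on G. u x = u' x"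
    and w: "(has_weak_grad_div G ^^ k) u w" "(has_weak_grad_div G ^^ k) u' w'"
  shows "AE x in lebesgue_on G. w x = w' x"
  using w
proof (induction k arbitrary: w w')
  case 0
  then show ?case using u by simp
next
  case (Suc k)
  from Suc.prems obtain z z' where z: "(has_weak_grad_div G ^^ k) u z" "has_weak_grad_div G z w"
    "(has_weak_grad_div G ^^ k) u' z'" "has_weak_grad_div G z' w'"
    by (metis relpowp_Suc_E)
  show ?case by (rule has_weak_grad_div_unique_AE[OF G z(2,4) Suc.IH[OF z(1,3)]])
qed

text \<open>A null field has inner product zero with everything, so potential 0 and divergence 0
  witness all the weak conditions. This converts equality almost everywhere into equality modulo
  \<open>A_H G\<close>.\<close>

lemma AE_zero_in_A_H:
  assumes L: "u \<in> L2 G" and z: "AE x in lebesgue_on G. u x = 0"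
  shows "u \<in> A_H G"
proof -
  have i: "L2_inner G u f = 0" for f
  proof -
    have "(LINT x|lebesgue_on G. u x \<bullet> f x) = 0"
      by (rule integral_eq_zero_AE) (use z in eventually_elim, simp)
    then show ?thesis by (simp add: L2_inner_def)
  qed
  have i0: "L2_inner G (\<lambda>x. 0) f = 0" for f :: "real^3 \<Rightarrow> 'b::euclidean_space" by (simp add: L2_inner_def)
  have "has_weak_grad G (\<lambda>x. 0) u" using L by (simp add: has_weak_grad_def L2_zero i i0)
  moreover have "has_weak_grad_div G u (\<lambda>x. 0)" using L by (simp add: has_weak_grad_div_def L2_zero i i0)
  moreover have "has_weak_div G u (\<lambda>x. 0)" using L by (simp add: has_weak_div_def L2_zero i i0)
  then have "zero_normal_trace G u" unfolding zero_normal_trace_def by (auto simp: i i0)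
  ultimately show ?thesis by (auto simp: A_H_def A_space_def)
qed

lemma A_space_L2: "f \<in> A_space G \<Longrightarrow> f \<in> L2 G"
  by (auto simp: A_space_def has_weak_grad_def)

section \<open>Spectral calculus in the fixed eigenbasis\<close>

context
  fixes G :: "(real^3) set" and \<nu> :: "nat \<Rightarrow> real" and q :: "nat \<Rightarrow> field3"
  assumes dom: "smooth_bounded_domain G" and basis: "grad_div_eigenbasis G \<nu> q"
begin

lemma dom_open: "open G" and dom_bounded: "bounded G"
  using dom by (auto simp: smooth_bounded_domain_def)

lemma
  shows q_A_zero: "q j \<in> A_zero G"
    and q_orthonormal: "L2_inner G (q i) (q j) = (if i = j then 1 else 0)"
    and q_complete: "f \<in> A_zero G \<Longrightarrow> L2_sums G (\<lambda>j x. L2_inner G f (q j) *\<^sub>R q j x) f"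
    and q_smooth: "smooth_closure G (q j)"
    and q_eigen: "x \<in> G \<Longrightarrow> - grad (divg (q j)) x = (\<nu> j)\<^sup>2 *\<^sub>R q j x"
    and q_normal: "x \<in> frontier G \<Longrightarrow> unit_normal G x \<bullet> q j x = 0"
    and nu_0: "0 < (\<nu> 0)\<^sup>2" and nu_mono: "(\<nu> 0)\<^sup>2 \<le> (\<nu> j)\<^sup>2"
  using basis by (auto simp: grad_div_eigenbasis_def dest: monoD[of _ 0 j])

lemma nu_nonzero: "\<nu> j \<noteq> 0"
  using nu_0 nu_mono[of j] by auto

lemma q_L2: "q j \<in> L2 G"
  using q_A_zero by (auto simp: A_zero_def intro: A_space_L2)

text \<open>\<open>P j\<close> is the divergence of a smooth extension of \<open>q j\<close>. The
  boundary condition on the basis removes the boundary term when the gradient of a potential is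
  paired with a basis field, which gives the orthogonality.\<close>

lemma q_potentials:
  obtains P where "\<And>j. has_weak_grad G (P j) (\<lambda>x. - (\<nu> j)\<^sup>2 *\<^sub>R q j x)"
    "\<And>i j. L2_inner G (P i) (P j) = (if i = j then (\<nu> i)\<^sup>2 else 0)"
    "\<And>j. has_weak_grad_div G (q j) (\<lambda>x. - (\<nu> j)\<^sup>2 *\<^sub>R q j x)"
proof -
  \<comment> \<open>Beyond the closure \<open>q j\<close> is arbitrary, so differentiation is done
    on an extension; on the open set \<open>G\<close> the derivatives coincide.\<close>
  have "\<exists>F. smooth_on UNIV F \<and> (\<forall>x\<in>closure G. q j x = F x)" for j
    using q_smooth[of j] by (simp add: smooth_closure_def)
  then obtain F where F: "\<And>j. smooth_on UNIV (F j)" "\<And>j x. x \<in> closure G \<Longrightarrow> q j x = F j x"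
    by metis
  define P where "P = (\<lambda>j. divg (F j))"
  have FC: "Ck_on n UNIV (F j)" for n j using F(1) by (simp add: smooth_on_def)
  have PC: "Ck_on n UNIV (P j)" for n j unfolding P_def by (rule Ck_on_divg[OF open_UNIV FC])
  have qF: "q j x = F j x" if "x \<in> G" for j x using F(2) that closure_subset by blast
  have fr: "frechet_derivative f (at x) = frechet_derivative g (at x)"
    if "g differentiable (at x)" "x \<in> G" "\<And>x. x \<in> G \<Longrightarrow> f x = g x"
    for f g :: "real^3 \<Rightarrow> 'b::real_normed_vector" and x
    using frechet_derivative_transform_within_open[OF that(1) dom_open that(2), of f] that(3) by simp
  have qP: "divg (q j) x = P j x" if "x \<in> G" for j x
  proof -
    have "frechet_derivative (q j) (at x) = frechet_derivative (F j) (at x)"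
      by (rule fr[OF Ck_on_1_differentiable[OF FC UNIV_I] that qF])
    then show ?thesis by (simp add: P_def divg_def)
  qed
  have "grad (divg (q j)) x = grad (P j) x" if "x \<in> G" for j x
  proof -
    have "frechet_derivative (divg (q j)) (at x) = frechet_derivative (P j) (at x)"
      by (rule fr[OF Ck_on_1_differentiable[OF PC UNIV_I] that qP])
    then show ?thesis by (simp add: grad_def)
  qed
  then have gradP: "grad (P j) x = - (\<nu> j)\<^sup>2 *\<^sub>R q j x" if "x \<in> G" for j x
    using arg_cong[OF q_eigen[OF that, of j], of uminus] that by simp
  have FN: "unit_normal G x \<bullet> F j x = 0" if "x \<in> frontier G" for j x
    using q_normal[OF that, of j] F(2)[of x j] that by (simp add: frontier_def)
  have PL: "P j \<in> L2 G" for j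
    by (rule continuous_L2[OF dom_open dom_bounded Ck_on_continuous_on[OF PC[of 0]]])
  have weak_grad: "L2_inner G (P j) (divg \<psi>) = - L2_inner G (\<lambda>x. - (\<nu> j)\<^sup>2 *\<^sub>R q j x) \<psi>"
    if t: "test_function G \<psi>" for j \<psi>
  proof -
    have "L2_inner G (grad (P j)) \<psi> = - L2_inner G (P j) (divg \<psi>)"
      by (rule integration_by_parts[OF dom PC test_functionD(1)[OF t]])
        (simp add: test_function_frontier[OF dom_open t])
    moreover have "L2_inner G (grad (P j)) \<psi> = L2_inner G (\<lambda>x. - (\<nu> j)\<^sup>2 *\<^sub>R q j x) \<psi>"
      by (rule L2_inner_cong[OF gradP refl])
    ultimately show ?thesis by simp
  qed
  show thesis
  proof (rule that[of P])
    show "has_weak_grad G (P j) (\<lambda>x. - (\<nu> j)\<^sup>2 *\<^sub>R q j x)" for j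
      unfolding has_weak_grad_def by (intro conjI allI impI PL L2_scaleR[OF q_L2] weak_grad)
    show "L2_inner G (P i) (P j) = (if i = j then (\<nu> i)\<^sup>2 else 0)" for i j
    proof -
      have "L2_inner G (grad (P i)) (F j) = - L2_inner G (P i) (P j)"
        unfolding P_def
        by (rule integration_by_parts[OF dom PC[unfolded P_def] FC]) (simp add: FN)
      moreover have "L2_inner G (grad (P i)) (F j) = L2_inner G (\<lambda>x. - (\<nu> i)\<^sup>2 *\<^sub>R q i x) (q j)"
        by (rule L2_inner_cong[OF gradP qF[symmetric]])
      moreover have "\<dots> = - (\<nu> i)\<^sup>2 * L2_inner G (q i) (q j)" by (rule L2_inner_scaleR_left)
      ultimately show ?thesis by (simp add: q_orthonormal split: if_splits)
    qed
    show "has_weak_grad_div G (q j) (\<lambda>x. - (\<nu> j)\<^sup>2 *\<^sub>R q j x)" for j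
      unfolding has_weak_grad_div_def
    proof (intro conjI allI impI q_L2 L2_scaleR)
      fix \<psi> :: field3 assume t: "test_function G \<psi>"
      note t' = test_function_divg[OF t]
      have "L2_inner G (q j) (grad (divg \<psi>)) = L2_inner G (grad (divg \<psi>)) (F j)"
        unfolding L2_inner_commute[of G "q j"] by (rule L2_inner_cong[OF refl qF])
      also have "\<dots> = - L2_inner G (divg \<psi>) (P j)" unfolding P_def
        by (rule integration_by_parts[OF dom test_functionD(1)[OF t'] FC]) (simp add: FN)
      also have "\<dots> = L2_inner G (\<lambda>x. - (\<nu> j)\<^sup>2 *\<^sub>R q j x) \<psi>"
        using weak_grad[OF t, of j] by (simp add: L2_inner_commute[of G "divg \<psi>"])
      finally show "L2_inner G (q j) (grad (divg \<psi>)) = L2_inner G (\<lambda>x. - (\<nu> j)\<^sup>2 *\<^sub>R q j x) \<psi>" .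
    qed
  qed
qed

lemma q_grad_div: "has_weak_grad_div G (q j) (\<lambda>x. - (\<nu> j)\<^sup>2 *\<^sub>R q j x)"
  by (rule q_potentials) blast

lemma q_grad_div_power: "(has_weak_grad_div G ^^ k) (q j) (\<lambda>x. (- (\<nu> j)\<^sup>2) ^ k *\<^sub>R q j x)"
proof (induction k)
  case (Suc k)
  have "has_weak_grad_div G (\<lambda>x. (- (\<nu> j)\<^sup>2) ^ k *\<^sub>R q j x) (\<lambda>x. (- (\<nu> j)\<^sup>2) ^ k *\<^sub>R (- (\<nu> j)\<^sup>2 *\<^sub>R q j x))"
    by (rule has_weak_grad_div_scaleR[OF q_grad_div])
  then show ?case using relpowp_Suc_I[OF Suc] by (simp add: mult.commute)
qed simp

lemma q_sums_ex:
  assumes "summable (\<lambda>j. (c j)\<^sup>2)"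
  obtains u where "L2_sums G (\<lambda>j x. c j *\<^sub>R q j x) u"
proof (rule L2_orthogonal_sums[OF dom_open dom_bounded, of "\<lambda>j x. c j *\<^sub>R q j x"])
  show "summable (\<lambda>j. L2_inner G (\<lambda>x. c j *\<^sub>R q j x) (\<lambda>x. c j *\<^sub>R q j x))"
    using assms by (simp add: L2_inner_scaleR_left L2_inner_scaleR_right q_orthonormal power2_eq_square)
qed (auto simp: L2_scaleR q_L2 L2_inner_scaleR_left L2_inner_scaleR_right q_orthonormal)

lemma q_sums_coefficient:
  assumes "L2_sums G (\<lambda>j x. c j *\<^sub>R q j x) u"
  shows "L2_inner G u (q i) = c i"
proof -
  have "(\<lambda>n. \<Sum>j<n. L2_inner G (\<lambda>x. c j *\<^sub>R q j x) (q i)) \<longlonglongrightarrow> L2_inner G u (q i)"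
    by (rule L2_sums_inner[OF assms q_L2])
  moreover have "eventually (\<lambda>n. (\<Sum>j<n. L2_inner G (\<lambda>x. c j *\<^sub>R q j x) (q i)) = c i) sequentially"
    using eventually_gt_at_top[of i]
    by eventually_elim (simp add: L2_inner_scaleR_left q_orthonormal if_distrib cong: if_cong)
  then have "(\<lambda>n. \<Sum>j<n. L2_inner G (\<lambda>x. c j *\<^sub>R q j x) (q i)) \<longlonglongrightarrow> c i" by (rule tendsto_eventually)
  ultimately show ?thesis by (rule LIMSEQ_unique)
qed

lemma summable_nu_lower:
  assumes "summable (\<lambda>j. \<nu> j ^ (4 * k) * (c j)\<^sup>2)"
  shows "summable (\<lambda>j. (c j)\<^sup>2)"
proof (rule summable_comparison_test_ev)
  show "summable (\<lambda>j. inverse (\<nu> 0 ^ (4 * k)) * (\<nu> j ^ (4 * k) * (c j)\<^sup>2))"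
    using assms by (rule summable_mult)
  have "norm ((c j)\<^sup>2) \<le> inverse (\<nu> 0 ^ (4 * k)) * (\<nu> j ^ (4 * k) * (c j)\<^sup>2)" for j
  proof -
    \<comment> \<open>Monotonicity is available for the squares of the \<nu> only, so the weight is
      written as a power of the square.\<close>
    have e: "\<nu> i ^ (4 * k) = ((\<nu> i)\<^sup>2) ^ (2 * k)" for i by (simp add: power_mult[symmetric])
    have "\<nu> 0 ^ (4 * k) \<le> \<nu> j ^ (4 * k)" unfolding e by (intro power_mono nu_mono) auto
    then have "\<nu> 0 ^ (4 * k) * (c j)\<^sup>2 \<le> \<nu> j ^ (4 * k) * (c j)\<^sup>2" by (intro mult_right_mono) auto
    moreover have "\<nu> 0 ^ (4 * k) > 0" unfolding e using nu_0 by simp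
    ultimately show ?thesis by (simp add: field_simps)
  qed
  then show "eventually (\<lambda>j. norm ((c j)\<^sup>2) \<le> inverse (\<nu> 0 ^ (4 * k)) * (\<nu> j ^ (4 * k) * (c j)\<^sup>2)) sequentially"
    by simp
qed

text \<open>The potentials of the partial sums converge as well, because the divergences of the basis fields
  are orthogonal with norms \<open>\<nu> j\<close>; no Poincare inequality is involved.\<close>

lemma q_sums_A_zero:
  assumes sm: "summable (\<lambda>j. (c j)\<^sup>2)" and u: "L2_sums G (\<lambda>j x. c j *\<^sub>R q j x) u"
  shows "u \<in> A_zero G"
proof -
  obtain P where P: "\<And>j. has_weak_grad G (P j) (\<lambda>x. - (\<nu> j)\<^sup>2 *\<^sub>R q j x)"
    and PP: "\<And>i j. L2_inner G (P i) (P j) = (if i = j then (\<nu> i)\<^sup>2 else 0)"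
    by (rule q_potentials) blast
  \<comment> \<open>Chosen so that the gradient of \<open>b j\<close> times \<open>P j\<close> is
    the j-th term of the given series.\<close>
  define b where "b = (\<lambda>j. - c j / (\<nu> j)\<^sup>2)"
  define h where "h = (\<lambda>j x. b j *\<^sub>R P j x)"
  have hw: "has_weak_grad G (h j) (\<lambda>x. c j *\<^sub>R q j x)" for j
    using has_weak_grad_scaleR[OF P[of j], of "b j"] nu_nonzero[of j] by (simp add: h_def b_def)
  then have hL: "h j \<in> L2 G" for j by (simp add: has_weak_grad_def)
  have hh: "L2_inner G (h i) (h j) = (if i = j then (c i)\<^sup>2 / (\<nu> i)\<^sup>2 else 0)" for i j
    unfolding h_def L2_inner_scaleR_left L2_inner_scaleR_right PP
    using nu_nonzero[of i] by (simp add: b_def power2_eq_square)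
  have "summable (\<lambda>j. (c j)\<^sup>2 / (\<nu> j)\<^sup>2)"
  proof (rule summable_comparison_test_ev)
    show "summable (\<lambda>j. (c j)\<^sup>2 / (\<nu> 0)\<^sup>2)" using sm by (rule summable_divide)
    have "norm ((c j)\<^sup>2 / (\<nu> j)\<^sup>2) \<le> (c j)\<^sup>2 / (\<nu> 0)\<^sup>2" for j
      using divide_left_mono[OF nu_mono[of j], of "(c j)\<^sup>2"] nu_0 nu_nonzero[of j] by simp
    then show "eventually (\<lambda>j. norm ((c j)\<^sup>2 / (\<nu> j)\<^sup>2) \<le> (c j)\<^sup>2 / (\<nu> 0)\<^sup>2) sequentially" by simp
  qed
  then have hs: "summable (\<lambda>j. L2_inner G (h j) (h j))" by (simp add: hh)
  have orth: "L2_inner G (h i) (h j) = 0" if "i \<noteq> j" for i j using that by (simp add: hh)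
  obtain H where H: "L2_sums G h H"
    by (rule L2_orthogonal_sums[OF dom_open dom_bounded hL orth hs])
  from has_weak_grad_sums[OF dom_open dom_bounded hw H u] have "u \<in> A_space G"
    by (auto simp: A_space_def)
  moreover have "L2_inner G u g = 0" if g: "g \<in> A_H G" for g
  proof -
    have gL: "g \<in> L2 G" using g by (auto simp: A_H_def intro: A_space_L2)
    have "L2_inner G (q j) g = 0" for j using q_A_zero[of j] g by (simp add: A_zero_def)
    then show ?thesis
      using L2_sums_inner[OF u gL] by (simp add: L2_inner_scaleR_left LIMSEQ_const_iff)
  qed
  ultimately show ?thesis by (simp add: A_zero_def)
qed

text \<open>One application multiplies the j-th coefficient by - nu_j^2 and uses up four powers of
  the weight. The remaining weight still makes the new series converge, and closedness identifies
  its sum as the image. Peeling off the first application requires generality in \<open>c\<close>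
  and \<open>u\<close>.\<close>

lemma q_sums_grad_div_power:
  assumes "summable (\<lambda>j. \<nu> j ^ (4 * k) * (c j)\<^sup>2)" "L2_sums G (\<lambda>j x. c j *\<^sub>R q j x) u"
  shows "\<exists>w. (has_weak_grad_div G ^^ k) u w \<and> L2_sums G (\<lambda>j x. ((- (\<nu> j)\<^sup>2) ^ k * c j) *\<^sub>R q j x) w"
  using assms
proof (induction k arbitrary: c u)
  case (Suc k)
  define c' where "c' = (\<lambda>j. - (\<nu> j)\<^sup>2 * c j)"
  have "\<nu> j ^ (4 * Suc k) * (c j)\<^sup>2 = \<nu> j ^ (4 * k) * (c' j)\<^sup>2" for j
    by (simp add: c'_def power_mult_distrib power_add power2_eq_square numeral_eq_Suc)
  with Suc.prems(1) have sm: "summable (\<lambda>j. \<nu> j ^ (4 * k) * (c' j)\<^sup>2)" by simp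
  obtain z where z: "L2_sums G (\<lambda>j x. c' j *\<^sub>R q j x) z"
    using q_sums_ex[OF summable_nu_lower[OF sm]] by blast
  have "has_weak_grad_div G (\<lambda>x. c j *\<^sub>R q j x) (\<lambda>x. c' j *\<^sub>R q j x)" for j
    using has_weak_grad_div_scaleR[OF q_grad_div[of j], of "c j"] by (simp add: c'_def mult.commute)
  from has_weak_grad_div_sums[OF dom_open dom_bounded this Suc.prems(2) z]
  have uz: "has_weak_grad_div G u z" .
  from Suc.IH[OF sm z] obtain w where zw: "(has_weak_grad_div G ^^ k) z w"
    and w: "L2_sums G (\<lambda>j x. ((- (\<nu> j)\<^sup>2) ^ k * c' j) *\<^sub>R q j x) w" by blast
  have "((- (\<nu> j)\<^sup>2) ^ k * c' j) = ((- (\<nu> j)\<^sup>2) ^ Suc k * c j)" for j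
    by (simp add: c'_def)
  with w have "L2_sums G (\<lambda>j x. ((- (\<nu> j)\<^sup>2) ^ Suc k * c j) *\<^sub>R q j x) w" by (simp only:)
  then show ?case using relpowp_Suc_I2[of "has_weak_grad_div G", OF uz zw] by blast
qed auto

lemma pairing_q: "pairing G q v (q j) = v j"
proof -
  have "pairing G q v (q j) = (\<Sum>i. if i = j then v j else 0)"
    unfolding pairing_def by (rule arg_cong[where f=suminf]) (auto simp: q_orthonormal)
  also have "\<dots> = v j" by (rule sums_unique[symmetric, OF sums_single])
  finally show ?thesis .
qed

lemma A_pos_sums: "u \<in> A_pos G \<nu> q k \<Longrightarrow> L2_sums G (\<lambda>j x. L2_inner G u (q j) *\<^sub>R q j x) u"
  by (simp add: A_pos_def q_complete)

text \<open>The series images \<open>w0\<close> and \<open>z0\<close> witness the existential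
  quantifiers, and uniqueness almost everywhere shows that any other images give the same inner
  products. The factor (- nu_j^2)^k occurs once from each side, so its sign disappears.\<close>

lemma solves_grad_div_eq_iff:
  assumes u: "u \<in> A_pos G \<nu> q k"
  shows "solves_grad_div_eq G q k v u \<longleftrightarrow> (\<forall>j. \<nu> j ^ (4 * k) * L2_inner G u (q j) = v j)"
proof -
  have sm: "summable (\<lambda>j. \<nu> j ^ (4 * k) * (L2_inner G u (q j))\<^sup>2)" using u by (simp add: A_pos_def)
  from q_sums_grad_div_power[OF sm A_pos_sums[OF u]] obtain w0 where
    w0: "(has_weak_grad_div G ^^ k) u w0"
    "L2_sums G (\<lambda>j x. ((- (\<nu> j)\<^sup>2) ^ k * L2_inner G u (q j)) *\<^sub>R q j x) w0" by blast
  define z0 where "z0 = (\<lambda>j x. (- (\<nu> j)\<^sup>2) ^ k *\<^sub>R q j x)"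
  have z0: "(has_weak_grad_div G ^^ k) (q j) (z0 j)" for j unfolding z0_def by (rule q_grad_div_power)
  have w0z0: "L2_inner G w0 (z0 j) = \<nu> j ^ (4 * k) * L2_inner G u (q j)" for j
  proof -
    have "L2_inner G w0 (z0 j) = (- (\<nu> j)\<^sup>2) ^ k * ((- (\<nu> j)\<^sup>2) ^ k * L2_inner G u (q j))"
      unfolding z0_def L2_inner_scaleR_right q_sums_coefficient[OF w0(2)] ..
    also have "\<dots> = ((- (\<nu> j)\<^sup>2) ^ k * (- (\<nu> j)\<^sup>2) ^ k) * L2_inner G u (q j)" by simp
    also have "(- (\<nu> j)\<^sup>2) ^ k * (- (\<nu> j)\<^sup>2) ^ k = \<nu> j ^ (4 * k)"
      by (simp add: power_mult_distrib[symmetric] power_mult power4_eq_xxxx power2_eq_square mult.assoc)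
    finally show ?thesis .
  qed
  have w0L: "w0 \<in> L2 G" and z0L: "z0 j \<in> L2 G" for j
    using w0(2) by (auto simp: L2_sums_def z0_def L2_scaleR q_L2)
  \<comment> \<open>For k = 0 the image is \<open>f\<close> itself; otherwise membership is part of
    the last weak relation.\<close>
  have L: "w \<in> L2 G" if "(has_weak_grad_div G ^^ k) f w" "f \<in> L2 G" for f w
    using that by (cases k) (auto simp: has_weak_grad_div_def)
  have uL: "u \<in> L2 G" using u by (auto simp: A_pos_def A_zero_def intro: A_space_L2)
  have eq: "L2_inner G w z = \<nu> j ^ (4 * k) * L2_inner G u (q j)"
    if w: "(has_weak_grad_div G ^^ k) u w" and z: "(has_weak_grad_div G ^^ k) (q j) z" for w z j
  proof -
    have "L2_inner G w z = L2_inner G w0 (z0 j)"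
      by (intro L2_inner_cong_AE L[OF w uL] w0L L[OF z q_L2] z0L
          has_weak_grad_div_power_unique_AE[OF dom_open dom_bounded _ w w0(1)]
          has_weak_grad_div_power_unique_AE[OF dom_open dom_bounded _ z z0]) auto
    then show ?thesis by (simp add: w0z0)
  qed
  show ?thesis
    unfolding solves_grad_div_eq_def pairing_q using eq w0(1) z0 by metis
qed

end

section \<open>Solvability, the series solution and uniqueness\<close>

theorem mainTheorem1:
  fixes G :: "(real^3) set" and \<nu> :: "nat \<Rightarrow> real" and q :: "nat \<Rightarrow> real^3 \<Rightarrow> real^3"
    and k :: nat and v :: "nat \<Rightarrow> real"
  assumes "smooth_bounded_domain G"
    and "grad_div_eigenbasis G \<nu> q"
    and "k \<ge> 1"
    and "v \<in> A_star \<nu>"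
  shows "((\<exists>u\<in>A_pos G \<nu> q k. solves_grad_div_eq G q k v u) \<longleftrightarrow> v \<in> A_neg \<nu> k) \<and>
    (v \<in> A_neg \<nu> k \<longrightarrow>
       (\<exists>u. L2_sums G (\<lambda>j x. (v j / \<nu> j ^ (4 * k)) *\<^sub>R q j x) u) \<and>
       (\<forall>u. L2_sums G (\<lambda>j x. (v j / \<nu> j ^ (4 * k)) *\<^sub>R q j x) u \<longrightarrow>
          u \<in> A_pos G \<nu> q k \<and> solves_grad_div_eq G q k v u)) \<and>
    (\<forall>u\<in>A_pos G \<nu> q k. \<forall>u'\<in>A_pos G \<nu> q k.
       solves_grad_div_eq G q k v u \<and> solves_grad_div_eq G q k v u' \<longrightarrow>
       (\<lambda>x. u x - u' x) \<in> A_H G)"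
proof -
  note D = assms(1,2)
  define c where "c = (\<lambda>j. v j / \<nu> j ^ (4 * k))"
  have n: "\<nu> j ^ (4 * k) \<noteq> 0" for j using nu_nonzero[OF D] by simp
  \<comment> \<open>This identity matches the weighted summability that defines \<open>A_pos\<close>
    with the one that defines \<open>A_neg\<close>, and it serves both directions of the
    criterion.\<close>
  have cv: "\<nu> j ^ (4 * k) * (c j)\<^sup>2 = (v j)\<^sup>2 / \<nu> j ^ (4 * k)" for j
    using nu_nonzero[OF D, of j] by (simp add: c_def power2_eq_square)
  have sol: "u \<in> A_pos G \<nu> q k \<and> solves_grad_div_eq G q k v u"
    if v: "v \<in> A_neg \<nu> k" and u: "L2_sums G (\<lambda>j x. c j *\<^sub>R q j x) u" for u
  proof -
    have sm: "summable (\<lambda>j. \<nu> j ^ (4 * k) * (c j)\<^sup>2)" using v by (simp add: A_neg_def cv)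
    have co: "L2_inner G u (q j) = c j" for j by (rule q_sums_coefficient[OF D u])
    have up: "u \<in> A_pos G \<nu> q k"
      using q_sums_A_zero[OF D summable_nu_lower[OF D sm] u] sm by (simp add: A_pos_def co)
    moreover have "solves_grad_div_eq G q k v u"
      unfolding solves_grad_div_eq_iff[OF D up] co using n by (simp add: c_def)
    ultimately show ?thesis ..
  qed
  have ex: "\<exists>u. L2_sums G (\<lambda>j x. c j *\<^sub>R q j x) u" if v: "v \<in> A_neg \<nu> k"
  proof -
    have sm: "summable (\<lambda>j. \<nu> j ^ (4 * k) * (c j)\<^sup>2)" using v by (simp add: A_neg_def cv)
    show ?thesis by (rule q_sums_ex[OF D summable_nu_lower[OF D sm]]) blast
  qed
  \<comment> \<open>Every solution has the coefficients of the series, which yields both the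
    necessity of \<open>A_neg\<close> and uniqueness.\<close>
  have coeff: "L2_inner G u (q j) = c j"
    if "u \<in> A_pos G \<nu> q k" "solves_grad_div_eq G q k v u" for u j
    using that solves_grad_div_eq_iff[OF D that(1)] n[of j] by (auto simp: c_def field_simps)
  have "v \<in> A_neg \<nu> k" if u: "u \<in> A_pos G \<nu> q k" "solves_grad_div_eq G q k v u" for u
    using u(1) by (simp add: A_pos_def A_neg_def coeff[OF u] cv)
  moreover have "(\<lambda>x. u x - u' x) \<in> A_H G"
    if u: "u \<in> A_pos G \<nu> q k" "solves_grad_div_eq G q k v u"
      and u': "u' \<in> A_pos G \<nu> q k" "solves_grad_div_eq G q k v u'" for u u'
  proof (rule AE_zero_in_A_H)
    have s: "L2_sums G (\<lambda>j x. c j *\<^sub>R q j x) u" "L2_sums G (\<lambda>j x. c j *\<^sub>R q j x) u'"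
      using A_pos_sums[OF D u(1)] A_pos_sums[OF D u'(1)] by (simp_all add: coeff[OF u] coeff[OF u'])
    then show "(\<lambda>x. u x - u' x) \<in> L2 G" by (auto simp: L2_sums_def intro: L2_diff)
    show "AE x in lebesgue_on G. u x - u' x = 0" using L2_sums_unique_AE[OF s] by simp
  qed
  ultimately show ?thesis using sol ex unfolding c_def by blast
qed

end
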